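(* Fix a graph $G=(V,E)$ with uncertainty intervals $(I_e)_{e\in E}$, and suppose the vector of true values $w$ is drawn from an unknown distribution $D$ from which i.i.d. samples can be drawn. For any $\varepsilon,\delta\in(0,1)$, there exists a learning algorithm that, using a training set of $m$ i.i.d. samples from $D$, returns predictions $\hat w\in\mathcal{H}$ such that, with probability at least $1-\delta$, $$\mathbb{E}_{w\sim D}[k_h(w,\hat w)]\le\mathbb{E}_{w\sim D}[k_h(w,\hat w^* )]+\varepsilon,$$ where $\hat w^*\in\arg\min_{\hat w'\in\mathcal{H}}\mathbb{E}_{w\sim D}[k_h(w,\hat w')]$. The sample complexity is $m\in O\!\left(\frac{(\log|E|-\log(\delta/|E|))\cdot|E|^2}{(\varepsilon/|E|)^2}\right)$ and the running time is polynomial in $m$ and $|E|$.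
   Context: Each edge $e$ has an uncertainty interval $I_e$, either open $(L_e,U_e)$ or trivial (then $L_e=U_e$), and the true value satisfies $w_e\in I_e$. $\mathcal{H}$ is the set of all prediction vectors $\hat w=(\hat w_e)_{e\in E}$ with $\hat w_e\in I_e$ for all $e$. For a true-value vector $w$ and predictions $\hat w$, the hop distance is $k_h(w,\hat w)=\sum_{e\in E}\sum_{e'\in E\setminus\{e\}}k_{e'}(e)$, where $k_{e'}(e)=0$ if $w_e$ and $\hat w_e$ lie in the same one of the regions $(-\infty,L_{e'}]$, $(L_{e'},U_{e'})$, $[U_{e'},\infty)$, and $k_{e'}(e)=1$ otherwise. *)

theory Defs
  imports "HOL-Probability.Probability"
begin

text \<open>Undirected finite graphs. Parallel edges and loops are allowed; a simple graph is the
  case where \<open>ends\<close> is the identity on a set of two-element sets.\<close>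

definition graph :: "'v set \<Rightarrow> 'e set \<Rightarrow> ('e \<Rightarrow> 'v set) \<Rightarrow> bool" where
  "graph V E ends \<longleftrightarrow> finite V \<and> finite E \<and>
     (\<forall>e\<in>E. ends e \<subseteq> V \<and> (card (ends e) = 1 \<or> card (ends e) = 2))"

definition ival :: "('e \<Rightarrow> real) \<Rightarrow> ('e \<Rightarrow> real) \<Rightarrow> 'e \<Rightarrow> real set" where
  "ival L U e = (if L e = U e then {L e} else {L e<..<U e})"

definition predictions :: "'e set \<Rightarrow> ('e \<Rightarrow> real) \<Rightarrow> ('e \<Rightarrow> real) \<Rightarrow> ('e \<Rightarrow> real) set" where
  "predictions E L U = (\<Pi>\<^sub>E e\<in>E. ival L U e)"

text \<open>If \<open>l = u\<close> then the two outer regions share the point \<open>l\<close>, and a value equal to \<open>l\<close>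
  is in the same region as every other value.\<close>

definition crosses :: "real \<Rightarrow> real \<Rightarrow> real \<Rightarrow> real \<Rightarrow> nat" where
  "crosses l u x y = (if \<exists>R\<in>{{..l}, {l<..<u}, {u..}}. x \<in> R \<and> y \<in> R then 0 else 1)"

definition hop_distance ::
  "'e set \<Rightarrow> ('e \<Rightarrow> real) \<Rightarrow> ('e \<Rightarrow> real) \<Rightarrow> ('e \<Rightarrow> real) \<Rightarrow> ('e \<Rightarrow> real) \<Rightarrow> nat" where
  "hop_distance E L U w p = (\<Sum>e\<in>E. \<Sum>e'\<in>E - {e}. crosses (L e') (U e') (w e) (p e))"

definition expected_hop ::
  "'e set \<Rightarrow> ('e \<Rightarrow> real) \<Rightarrow> ('e \<Rightarrow> real) \<Rightarrow> ('e \<Rightarrow> real) measure \<Rightarrow> ('e \<Rightarrow> real) \<Rightarrow> real" where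
  "expected_hop E L U D p = (\<integral>w. real (hop_distance E L U w p) \<partial>D)"

text \<open>Borel probability distributions of the vector of true values; the underlying space is
  the product of the uncertainty intervals.\<close>

definition value_distribution ::
  "'e set \<Rightarrow> ('e \<Rightarrow> real) \<Rightarrow> ('e \<Rightarrow> real) \<Rightarrow> ('e \<Rightarrow> real) measure \<Rightarrow> bool" where
  "value_distribution E L U D \<longleftrightarrow>
     prob_space D \<and> sets D = sets (\<Pi>\<^sub>M e\<in>E. restrict_space borel (ival L U e))"

text \<open>
  Running time is measured on a real RAM, given as a structured programming language. A
  state consists of registers for natural numbers and of a two-dimensional memory of exact
  reals, which is addressed by natural-number expressions. Every assignment and every test
  costs one unit; expressions have a size fixed by the program, so charging them one unit only
  affects constants. Natural numbers have no multiplication, reals cannot be rounded to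
  integers, and the only literals are integers; otherwise unit cost would be too generous.
  Division by zero yields zero and subtraction of natural numbers is truncated.
\<close>

datatype nexp = NConst nat | NReg nat | NPlus nexp nexp | NMinus nexp nexp

datatype rexp = RConst int | RCell nexp nexp
  | RPlus rexp rexp | RMinus rexp rexp | RTimes rexp rexp | RDivide rexp rexp

datatype bexp = NLess nexp nexp | RLess rexp rexp | BNot bexp | BAnd bexp bexp

datatype com = Skip | NAssign nat nexp | RAssign nexp nexp rexp
  | Seq com com | If bexp com com | While bexp com

record ram_state =
  reg :: "nat \<Rightarrow> nat"
  cell :: "nat \<Rightarrow> nat \<Rightarrow> real"

primrec nval :: "nexp \<Rightarrow> ram_state \<Rightarrow> nat" where
  "nval (NConst k) s = k"
| "nval (NReg x) s = reg s x"
| "nval (NPlus a b) s = nval a s + nval b s"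
| "nval (NMinus a b) s = nval a s - nval b s"

primrec rval :: "rexp \<Rightarrow> ram_state \<Rightarrow> real" where
  "rval (RConst z) s = of_int z"
| "rval (RCell a b) s = cell s (nval a s) (nval b s)"
| "rval (RPlus a b) s = rval a s + rval b s"
| "rval (RMinus a b) s = rval a s - rval b s"
| "rval (RTimes a b) s = rval a s * rval b s"
| "rval (RDivide a b) s = rval a s / rval b s"

primrec bval :: "bexp \<Rightarrow> ram_state \<Rightarrow> bool" where
  "bval (NLess a b) s \<longleftrightarrow> nval a s < nval b s"
| "bval (RLess a b) s \<longleftrightarrow> rval a s < rval b s"
| "bval (BNot b) s \<longleftrightarrow> \<not> bval b s"
| "bval (BAnd a b) s \<longleftrightarrow> bval a s \<and> bval b s"

text \<open>\<open>exec c s t s'\<close>: started in \<open>s\<close>, the program \<open>c\<close> halts in \<open>s'\<close> after \<open>t\<close> steps.\<close>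

inductive exec :: "com \<Rightarrow> ram_state \<Rightarrow> nat \<Rightarrow> ram_state \<Rightarrow> bool" where
  Skip: "exec Skip s 1 s"
| NAssign: "exec (NAssign x a) s 1 (s\<lparr>reg := (reg s)(x := nval a s)\<rparr>)"
| RAssign: "exec (RAssign a b r) s 1
    (s\<lparr>cell := (cell s)(nval a s := (cell s (nval a s))(nval b s := rval r s))\<rparr>)"
| Seq: "exec c s t s' \<Longrightarrow> exec d s' u s'' \<Longrightarrow> exec (Seq c d) s (t + u) s''"
| IfTrue: "bval b s \<Longrightarrow> exec c s t s' \<Longrightarrow> exec (If b c d) s (t + 1) s'"
| IfFalse: "\<not> bval b s \<Longrightarrow> exec d s t s' \<Longrightarrow> exec (If b c d) s (t + 1) s'"
| WhileFalse: "\<not> bval b s \<Longrightarrow> exec (While b c) s 1 s"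
| WhileTrue: "bval b s \<Longrightarrow> exec c s t s' \<Longrightarrow> exec (While b c) s' u s'' \<Longrightarrow>
    exec (While b c) s (t + u + 1) s''"

inductive_cases exec_SkipE: "exec Skip s t s'"
inductive_cases exec_NAssignE: "exec (NAssign x a) s t s'"
inductive_cases exec_RAssignE: "exec (RAssign a b r) s t s'"
inductive_cases exec_SeqE: "exec (Seq c d) s t s'"
inductive_cases exec_IfE: "exec (If b c d) s t s'"
inductive_cases exec_WhileE: "exec (While b c) s t s'"

lemma exec_deterministic:
  "exec c s t s' \<Longrightarrow> exec c s u s'' \<Longrightarrow> t = u \<and> s' = s''"
proof (induction arbitrary: u s'' rule: exec.induct)
  case Skip
  then show ?case by (auto elim: exec_SkipE)
next
  case NAssign
  then show ?case by (auto elim: exec_NAssignE)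
next
  case RAssign
  then show ?case by (auto elim: exec_RAssignE)
next
  case Seq
  from Seq.prems show ?case by (rule exec_SeqE) (auto dest!: Seq.IH)
next
  case IfTrue
  from IfTrue.prems show ?case
    by (rule exec_IfE) (use IfTrue.hyps in \<open>auto dest!: IfTrue.IH\<close>)
next
  case IfFalse
  from IfFalse.prems show ?case
    by (rule exec_IfE) (use IfFalse.hyps in \<open>auto dest!: IfFalse.IH\<close>)
next
  case WhileFalse
  from WhileFalse.prems show ?case
    by (rule exec_WhileE) (use WhileFalse.hyps in auto)
next
  case WhileTrue
  from WhileTrue.prems show ?case
    by (rule exec_WhileE) (use WhileTrue.hyps in \<open>auto dest!: WhileTrue.IH\<close>)
qed

text \<open>The edges are presented in an order \<open>enum 0, \<dots>, enum (n - 1)\<close>. Registers 0 and 1 hold the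
  number of edges and the number of samples; memory rows 0 and 1 hold the lower and the upper
  interval limits, row \<open>j + 3\<close> the sample \<open>S j\<close>, and row 2 receives the result.\<close>

definition initial_state ::
  "'e set \<Rightarrow> (nat \<Rightarrow> 'e) \<Rightarrow> ('e \<Rightarrow> real) \<Rightarrow> ('e \<Rightarrow> real) \<Rightarrow> nat \<Rightarrow> (nat \<Rightarrow> 'e \<Rightarrow> real) \<Rightarrow> ram_state" where
  "initial_state E enum L U m S =
     \<lparr>reg = (\<lambda>_. 0)(0 := card E, 1 := m),
      cell = (\<lambda>r i. if i < card E then
                       if r = 0 then L (enum i)
                       else if r = 1 then U (enum i)
                       else if 3 \<le> r \<and> r < m + 3 then S (r - 3) (enum i)
                       else 0
                     else 0)\<rparr>"

definition computes ::
  "com \<Rightarrow> 'e set \<Rightarrow> (nat \<Rightarrow> 'e) \<Rightarrow> ('e \<Rightarrow> real) \<Rightarrow> ('e \<Rightarrow> real) \<Rightarrow> nat \<Rightarrow> (nat \<Rightarrow> 'e \<Rightarrow> real) \<Rightarrow>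
     ('e \<Rightarrow> real) \<Rightarrow> nat \<Rightarrow> bool" where
  "computes P E enum L U m S p t \<longleftrightarrow>
     (\<exists>s. exec P (initial_state E enum L U m S) t s \<and> (\<forall>i<card E. cell s 2 i = p (enum i)))"

end

(*
  The hop distance is a sum over the edges, and the summand of an edge depends on its prediction
  only through comparisons with the interval limits. Every prediction can therefore be replaced,
  at equal cost for all true values, by a midpoint of two (possibly equal) interval limits. The
  learner minimises, separately for every edge, the empirical cost over these at most 4 |E|^2
  candidates. By Hoeffding's inequality and a union bound over edges and candidates all
  empirical means are within \<epsilon> / (2 |E|) of the expectations, so every edge loses at most
  \<epsilon> / |E|.
*)

theory Submission
  imports Defs
begin

section \<open>Empirical risk minimisation over midpoints of interval limits\<close>

text \<open>The limits alone would not do as candidates: in an open interval the edge's own limits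
  are forbidden, and the cost can be smaller strictly between two neighbouring limits. The limits
  themselves are needed too: next to the intervals (0,1) and (1,2), the value 1 lies in an outer
  region of both, unlike the values just below and just above it. The candidates depend on the
  intervals only, not on the samples. So they are fixed before sampling, which makes a finite union
  bound legitimate although an edge has a continuum of predictions. The same finiteness shows that
  the optimal prediction exists and that the learner is measurable. The cost of an edge ranges up to
  |E| and is estimated to accuracy \<epsilon> / (2 |E|), so Hoeffding's exponent is m \<epsilon>^2 /
  (2 |E|^4); this is the source of |E|^4 / \<epsilon>^2 in the sample size. The learner compares
  sums of costs instead of means, so that all counting happens in natural-number registers.\<close>

definition feasible :: "real \<Rightarrow> real \<Rightarrow> real \<Rightarrow> bool" where
  "feasible l u y \<longleftrightarrow> (if l = u then y = l else l < y \<and> y < u)"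

definition edge_cost ::
  "nat \<Rightarrow> (nat \<Rightarrow> real) \<Rightarrow> (nat \<Rightarrow> real) \<Rightarrow> nat \<Rightarrow> real \<Rightarrow> real \<Rightarrow> nat" where
  "edge_cost n l u i x y = (\<Sum>k<n. if k \<noteq> i then crosses (l k) (u k) x y else 0)"

text \<open>Below, \<open>c\<close> is a memory table as in \<^const>\<open>initial_state\<close>: rows 0 and 1 are the interval
  limits, row \<open>j + 3\<close> is the \<open>j\<close>-th sample.\<close>

definition empirical_cost :: "nat \<Rightarrow> nat \<Rightarrow> (nat \<Rightarrow> nat \<Rightarrow> real) \<Rightarrow> nat \<Rightarrow> real \<Rightarrow> nat" where
  "empirical_cost n m c i y = (\<Sum>j<m. edge_cost n (c 0) (c 1) i (c (j + 3) i) y)"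

text \<open>The nesting repeats that of the program's loops over registers 3 to 6, so each level
  fits the conclusion of \<open>runs_For_fold\<close>, and ties are resolved as in the
  program.\<close>

definition candidates :: "nat \<Rightarrow> (nat \<Rightarrow> nat \<Rightarrow> real) \<Rightarrow> real list" where
  "candidates n c =
     concat (map (\<lambda>r. concat (map (\<lambda>k. concat (map (\<lambda>r'. concat (map (\<lambda>k'.
       [(c r k + c r' k') / 2]) [0..<n])) [0..<2])) [0..<n])) [0..<2])"

text \<open>The first component of the pair is one plus the cost of the second component; it is 0
  as long as no feasible value has been found.\<close>

definition improve :: "('a \<Rightarrow> bool) \<Rightarrow> ('a \<Rightarrow> nat) \<Rightarrow> 'a \<Rightarrow> nat \<times> 'a \<Rightarrow> nat \<times> 'a" where
  "improve P f y = (\<lambda>(b, v). if P y \<and> (b = 0 \<or> f y + 1 < b) then (f y + 1, y) else (b, v))"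

definition erm :: "nat \<Rightarrow> nat \<Rightarrow> (nat \<Rightarrow> nat \<Rightarrow> real) \<Rightarrow> nat \<Rightarrow> real" where
  "erm n m c i =
     snd (fold (improve (feasible (c 0 i) (c 1 i)) (empirical_cost n m c i)) (candidates n c) (0, 0))"

text \<open>Appending at the end makes \<open>improve\<close> the last step of the fold. While
  \<open>b\<close> is 0 the second component is the meaningless start value \<open>v0\<close>, hence
  the split on \<open>b\<close>.\<close>

lemma fold_improve:
  assumes "fold (improve P f) ys (0, v0) = (b, v)"
  shows "(b = 0 \<longrightarrow> (\<forall>y\<in>set ys. \<not> P y)) \<and>
    (b > 0 \<longrightarrow> v \<in> set ys \<and> P v \<and> b = f v + 1 \<and> (\<forall>y\<in>set ys. P y \<longrightarrow> f v \<le> f y))"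
  using assms
proof (induction ys arbitrary: b v rule: rev_induct)
  case Nil
  then show ?case by simp
next
  case (snoc y ys)
  obtain b' v' where bv: "fold (improve P f) ys (0, v0) = (b', v')" by fastforce
  have step: "improve P f y (b', v') = (b, v)" using snoc.prems by (simp add: bv)
  show ?case
    using snoc.IH[OF bv] step by (auto simp: improve_def split: if_splits)
qed

lemma set_candidates:
  "set (candidates n c) = {(c r k + c r' k') / 2 | r k r' k'. r < 2 \<and> k < n \<and> r' < 2 \<and> k' < n}"
  unfolding candidates_def by (fastforce simp: atLeast0LessThan)

lemma length_candidates: "length (candidates n c) = 4 * n\<^sup>2"
  by (simp add: candidates_def length_concat o_def sum_list_triv power2_eq_square numeral_eq_Suc algebra_simps)

lemma feasible_midpoint: "l \<le> u \<Longrightarrow> feasible l u ((l + u) / 2)"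
  by (auto simp: feasible_def field_simps)

lemma erm_optimal:
  assumes "i < n" "c 0 i \<le> c 1 i"
  shows "feasible (c 0 i) (c 1 i) (erm n m c i)"
    and "erm n m c i \<in> set (candidates n c)"
    and "\<And>y. y \<in> set (candidates n c) \<Longrightarrow> feasible (c 0 i) (c 1 i) y \<Longrightarrow>
           empirical_cost n m c i (erm n m c i) \<le> empirical_cost n m c i y"
proof -
  obtain b v where bv: "fold (improve (feasible (c 0 i) (c 1 i)) (empirical_cost n m c i))
      (candidates n c) (0, 0) = (b, v)" by fastforce
  \<comment> \<open>The midpoint of the edge's own limits is a feasible candidate, so the search
    cannot end with its start value.\<close>
  have mem: "(c 0 i + c 1 i) / 2 \<in> set (candidates n c)"
    unfolding set_candidates using assms(1) by force
  have b: "b > 0"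
    using fold_improve[OF bv] mem feasible_midpoint[OF assms(2)] by blast
  have v: "erm n m c i = v" unfolding erm_def bv by simp
  show "feasible (c 0 i) (c 1 i) (erm n m c i)" "erm n m c i \<in> set (candidates n c)"
    "\<And>y. y \<in> set (candidates n c) \<Longrightarrow> feasible (c 0 i) (c 1 i) y \<Longrightarrow>
       empirical_cost n m c i (erm n m c i) \<le> empirical_cost n m c i y"
    using fold_improve[OF bv] b unfolding v by blast+
qed

text \<open>Comparisons of \<open>y\<close> with \<open>l\<close> and \<open>u\<close> decide in
  which of the three regions it lies. Both strict directions occur because equality with a limit
  matters: the outer regions are closed.\<close>

lemma crosses_cong:
  assumes "y < l \<longleftrightarrow> z < l" "l < y \<longleftrightarrow> l < z" "y < u \<longleftrightarrow> z < u" "u < y \<longleftrightarrow> u < z"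
  shows "crosses l u x y = crosses l u x z"
proof -
  have "y \<in> R \<longleftrightarrow> z \<in> R" if "R \<in> {{..l}, {l<..<u}, {u..}}" for R
    using that assms by (auto simp: not_less[symmetric])
  then show ?thesis unfolding crosses_def by auto
qed

text \<open>A point outside \<open>T\<close> lies in a gap between two neighbours in
  \<open>T\<close>, and the middle of that gap compares in the same way with all of
  \<open>T\<close>. A point of \<open>T\<close> is the midpoint of itself and itself. The assumption
  on \<open>y\<close> excludes the two unbounded gaps.\<close>

lemma midpoint_same_comparisons:
  fixes T :: "real set"
  assumes T: "finite T" and y: "y \<in> T \<or> (\<exists>a\<in>T. a < y) \<and> (\<exists>b\<in>T. y < b)"
  shows "\<exists>a\<in>T. \<exists>b\<in>T. \<forall>t\<in>T. (y < t \<longleftrightarrow> (a + b) / 2 < t) \<and> (t < y \<longleftrightarrow> t < (a + b) / 2)"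
proof (cases "y \<in> T")
  case True
  then show ?thesis by (intro bexI[of _ y]) auto
next
  case False
  define A where "A = {t\<in>T. t < y}"
  define B where "B = {t\<in>T. y < t}"
  have fin: "finite A" "finite B" and ne: "A \<noteq> {}" "B \<noteq> {}"
    using T y False by (auto simp: A_def B_def)
  have a: "Max A \<in> T" "Max A < y" and b: "Min B \<in> T" "y < Min B"
    using Max_in[OF fin(1) ne(1)] Min_in[OF fin(2) ne(2)] by (auto simp: A_def B_def)
  have "(y < t \<longleftrightarrow> (Max A + Min B) / 2 < t) \<and> (t < y \<longleftrightarrow> t < (Max A + Min B) / 2)"
    if t: "t \<in> T" for t
  proof (cases "t < y")
    case True
    then have "t \<le> Max A" using fin t by (auto simp: A_def)
    with a b True show ?thesis by auto
  next
    case F: False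
    with t False have "y < t" by (metis linorder_neqE)
    then have "Min B \<le> t" using fin t by (auto simp: B_def)
    with a b \<open>y < t\<close> show ?thesis by auto
  qed
  with a b show ?thesis by blast
qed

lemma candidate_same_cost:
  assumes i: "i < n" and y: "feasible (c 0 i) (c 1 i) y"
  shows "\<exists>z\<in>set (candidates n c). feasible (c 0 i) (c 1 i) z \<and>
    (\<forall>x. edge_cost n (c 0) (c 1) i x z = edge_cost n (c 0) (c 1) i x y)"
proof -
  define T where "T = (\<lambda>(r, k). c r k) ` ({..<2} \<times> {..<n})"
  have mem: "c 0 k \<in> T" "c 1 k \<in> T" if "k < n" for k
    using that by (force simp: T_def)+
  have "finite T" by (simp add: T_def)
  \<comment> \<open>An open interval has its limits on both sides of \<open>y\<close>; in a trivial
    one \<open>y\<close> is itself a limit.\<close>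
  moreover have "y \<in> T \<or> (\<exists>a\<in>T. a < y) \<and> (\<exists>b\<in>T. y < b)"
    using y mem[OF i] by (auto simp: feasible_def split: if_splits)
  ultimately obtain a b where ab: "a \<in> T" "b \<in> T" and
    cmp: "\<And>t. t \<in> T \<Longrightarrow> (y < t \<longleftrightarrow> (a + b) / 2 < t) \<and> (t < y \<longleftrightarrow> t < (a + b) / 2)"
    using midpoint_same_comparisons[of T y] by blast
  define z where "z = (a + b) / 2"
  have cmp: "\<And>t. t \<in> T \<Longrightarrow> (y < t \<longleftrightarrow> z < t) \<and> (t < y \<longleftrightarrow> t < z)"
    using cmp by (simp add: z_def)
  have "z \<in> set (candidates n c)"
    using ab unfolding set_candidates z_def T_def by fastforce
  \<comment> \<open>Feasibility is again decided by comparisons with two elements of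
    \<open>T\<close>.\<close>
  moreover have "feasible (c 0 i) (c 1 i) z"
    using y cmp[OF mem(1)[OF i]] cmp[OF mem(2)[OF i]]
    by (auto simp: feasible_def split: if_splits)
  moreover have "edge_cost n (c 0) (c 1) i x z = edge_cost n (c 0) (c 1) i x y" for x
    unfolding edge_cost_def
  proof (intro sum.cong refl if_cong crosses_cong)
    fix k assume "k \<in> {..<n}"
    then have "c 0 k \<in> T" "c 1 k \<in> T" using mem by auto
    then show "z < c 0 k \<longleftrightarrow> y < c 0 k" "c 0 k < z \<longleftrightarrow> c 0 k < y"
      "z < c 1 k \<longleftrightarrow> y < c 1 k" "c 1 k < z \<longleftrightarrow> c 1 k < y" using cmp by blast+
  qed
  ultimately show ?thesis by blast
qed

lemma crosses_le_1: "crosses l u x y \<le> 1"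
  by (simp add: crosses_def)

lemma edge_cost_le: "edge_cost n l u i x y \<le> n"
proof -
  have "edge_cost n l u i x y \<le> (\<Sum>k<n. 1)"
    unfolding edge_cost_def by (intro sum_mono) (use crosses_le_1 in auto)
  then show ?thesis by simp
qed

section \<open>The program\<close>

definition For :: "nat \<Rightarrow> nexp \<Rightarrow> com \<Rightarrow> com" where
  "For x a p = Seq (NAssign x (NConst 0))
     (While (NLess (NReg x) a) (Seq p (NAssign x (NPlus (NReg x) (NConst 1)))))"

abbreviation BOr :: "bexp \<Rightarrow> bexp \<Rightarrow> bexp" where
  "BOr a b \<equiv> BNot (BAnd (BNot a) (BNot b))"

text \<open>Register 2 is the current edge, registers 3 to 6 range over the pairs of interval limits,
  7 over the samples and 8 over the edges; 9 and 10 are the current cost and one plus the best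
  cost. The best value is kept in the output cell.\<close>

abbreviation candidate_exp :: rexp where
  "candidate_exp \<equiv> RDivide (RPlus (RCell (NReg 3) (NReg 4)) (RCell (NReg 5) (NReg 6))) (RConst 2)"

text \<open>The three conjuncts deny that both points lie in the lower, the middle and the upper
  region; a non-strict comparison is a negated \<open>RLess\<close> in the opposite
  direction.\<close>

abbreviation crosses_exp :: "rexp \<Rightarrow> rexp \<Rightarrow> rexp \<Rightarrow> rexp \<Rightarrow> bexp" where
  "crosses_exp l u x y \<equiv>
     BAnd (BOr (RLess l x) (RLess l y))
      (BAnd (BNot (BAnd (BAnd (RLess l x) (RLess x u)) (BAnd (RLess l y) (RLess y u))))
        (BOr (RLess x u) (RLess y u)))"

abbreviation feasible_exp :: "rexp \<Rightarrow> rexp \<Rightarrow> rexp \<Rightarrow> bexp" where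
  "feasible_exp l u y \<equiv>
     BOr (BAnd (RLess l y) (RLess y u))
      (BAnd (BAnd (BNot (RLess l u)) (BNot (RLess u l))) (BAnd (BNot (RLess l y)) (BNot (RLess y l))))"

definition count_edge :: com where
  "count_edge = If (BAnd (BOr (NLess (NReg 8) (NReg 2)) (NLess (NReg 2) (NReg 8)))
       (crosses_exp (RCell (NConst 0) (NReg 8)) (RCell (NConst 1) (NReg 8))
          (RCell (NPlus (NReg 7) (NConst 3)) (NReg 2)) candidate_exp))
     (NAssign 9 (NPlus (NReg 9) (NConst 1))) Skip"

definition count_samples :: com where
  "count_samples = For 7 (NReg 1) (For 8 (NReg 0) count_edge)"

definition try_candidate :: com where
  "try_candidate = Seq (NAssign 9 (NConst 0)) (Seq count_samples
     (If (BAnd (feasible_exp (RCell (NConst 0) (NReg 2)) (RCell (NConst 1) (NReg 2)) candidate_exp)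
            (BOr (NLess (NReg 10) (NConst 1)) (NLess (NPlus (NReg 9) (NConst 1)) (NReg 10))))
        (Seq (NAssign 10 (NPlus (NReg 9) (NConst 1))) (RAssign (NConst 2) (NReg 2) candidate_exp))
        Skip))"

definition erm_program :: com where
  "erm_program = For 2 (NReg 0) (Seq (NAssign 10 (NConst 0))
     (For 3 (NConst 2) (For 4 (NReg 0) (For 5 (NConst 2) (For 6 (NReg 0) try_candidate)))))"

section \<open>Time-bounded total correctness and loop rules\<close>

definition runs :: "com \<Rightarrow> nat \<Rightarrow> ram_state \<Rightarrow> (ram_state \<Rightarrow> bool) \<Rightarrow> bool" where
  "runs p T s Q \<longleftrightarrow> (\<exists>t\<le>T. \<exists>s'. exec p s t s' \<and> Q s')"

lemma runs_mono:
  "runs p T s Q \<Longrightarrow> T \<le> T' \<Longrightarrow> (\<And>s'. Q s' \<Longrightarrow> Q' s') \<Longrightarrow> runs p T' s Q'"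
  unfolding runs_def by (meson order.trans)

lemma runs_Skip: "Q s \<Longrightarrow> runs Skip 1 s Q"
  unfolding runs_def by (blast intro: exec.Skip)

lemma runs_NAssign: "Q (s\<lparr>reg := (reg s)(x := nval a s)\<rparr>) \<Longrightarrow> runs (NAssign x a) 1 s Q"
  unfolding runs_def by (blast intro: exec.NAssign)

lemma runs_RAssign:
  "Q (s\<lparr>cell := (cell s)(nval a s := (cell s (nval a s))(nval b s := rval r s))\<rparr>) \<Longrightarrow>
   runs (RAssign a b r) 1 s Q"
  unfolding runs_def by (blast intro: exec.RAssign)

lemma runs_Seq: "runs p T s (\<lambda>s'. runs q T' s' Q) \<Longrightarrow> runs (Seq p q) (T + T') s Q"
  unfolding runs_def by (blast intro: exec.Seq add_mono)

lemma runs_If: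
  "(bval b s \<Longrightarrow> runs p T s Q) \<Longrightarrow> (\<not> bval b s \<Longrightarrow> runs q T s Q) \<Longrightarrow> runs (If b p q) (T + 1) s Q"
  unfolding runs_def by (cases "bval b s") (blast intro: exec.IfTrue exec.IfFalse add_mono)+

text \<open>A round costs the body, the increment and the successful test, hence
  \<open>T + 2\<close>; the initial assignment and the final failing test give the last 2. The
  invariant is demanded after the increment and \<open>counter\<close> ties its index to the
  register, so the body needs no separate condition on the counter.\<close>

lemma runs_For:
  assumes init: "I 0 (s\<lparr>reg := (reg s)(x := 0)\<rparr>)"
    and counter: "\<And>k s. I k s \<Longrightarrow> reg s x = k \<and> nval a s = N"
    and step: "\<And>k s. k < N \<Longrightarrow> I k s \<Longrightarrow>
      runs p T s (\<lambda>s'. I (Suc k) (s'\<lparr>reg := (reg s')(x := reg s' x + 1)\<rparr>))"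
  shows "runs (For x a p) (N * (T + 2) + 2) s (I N)"
proof -
  let ?b = "NLess (NReg x) a" and ?p = "Seq p (NAssign x (NPlus (NReg x) (NConst 1)))"
  have loop: "runs (While ?b ?p) ((N - k) * (T + 2) + 1) s (I N)" if "k \<le> N" "I k s" for k s
    using that
  proof (induction "N - k" arbitrary: k s)
    case 0
    then have "k = N" by simp
    then have "\<not> bval ?b s" using counter[OF \<open>I k s\<close>] by simp
    then have "exec (While ?b ?p) s 1 s" by (rule exec.WhileFalse)
    with \<open>I k s\<close> \<open>k = N\<close> show ?case unfolding runs_def by auto
  next
    case (Suc d)
    then have k: "k < N" "d = N - Suc k" by auto
    have b: "bval ?b s" using counter[OF \<open>I k s\<close>] k by simp
    have "runs ?p (T + 1) s (I (Suc k))"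
      using step[OF k(1) \<open>I k s\<close>]
      by (intro runs_Seq) (erule runs_mono, simp, intro runs_NAssign, simp)
    then obtain t s' where t: "t \<le> T + 1" "exec ?p s t s'" "I (Suc k) s'"
      unfolding runs_def by blast
    have "runs (While ?b ?p) ((N - Suc k) * (T + 2) + 1) s' (I N)"
      using k t by (intro Suc.hyps(1)) auto
    then obtain t' s'' where t': "t' \<le> (N - Suc k) * (T + 2) + 1" "exec (While ?b ?p) s' t' s''" "I N s''"
      unfolding runs_def by blast
    have "exec (While ?b ?p) s (t + t' + 1) s''"
      by (rule exec.WhileTrue[OF b t(2) t'(2)])
    moreover have "t + t' + 1 \<le> (N - k) * (T + 2) + 1"
    proof -
      have "N - k = Suc (N - Suc k)" using k by simp
      then show ?thesis using t(1) t'(1) by simp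
    qed
    ultimately show ?case using t'(3) unfolding runs_def by blast
  qed
  have "runs (For x a p) (1 + (N * (T + 2) + 1)) s (I N)"
    unfolding For_def using loop[of 0 "s\<lparr>reg := (reg s)(x := 0)\<rparr>"] init
    by (intro runs_Seq runs_NAssign) simp
  then show ?thesis by simp
qed

text \<open>A search for edge \<open>i\<close> writes only one cell, so the results already stored
  in row 2 for other edges survive.\<close>

definition frame :: "nat set \<Rightarrow> nat \<Rightarrow> ram_state \<Rightarrow> ram_state \<Rightarrow> bool" where
  "frame X i s s' \<longleftrightarrow> (\<forall>x. x \<notin> X \<longrightarrow> reg s' x = reg s x) \<and>
     (\<forall>r k. (r, k) \<noteq> (2, i) \<longrightarrow> cell s' r k = cell s r k)"

text \<open>The machine image of the accumulator of \<open>improve\<close>; program and fold are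
  related by an equation between such pairs.\<close>

definition incumbent :: "nat \<Rightarrow> ram_state \<Rightarrow> nat \<times> real" where
  "incumbent i s = (reg s 10, cell s 2 i)"

text \<open>The conclusion has the shape that \<open>body\<close> demands in the next outer loop,
  with the counter added to the changeable registers, so the rule can be applied to nested loops
  level by level. Here \<open>x \<notin> X\<close> makes the body respect the counter, and
  \<open>x \<noteq> 10\<close> keeps the counter away from the stored cost.\<close>

lemma runs_For_fold:
  assumes x: "x \<noteq> 10" "x \<notin> X"
    and bound: "\<And>s'. frame (insert x X) i s s' \<Longrightarrow> nval a s' = N"
    and body: "\<And>s' k. frame (insert x X) i s s' \<Longrightarrow> reg s' x = k \<Longrightarrow> k < N \<Longrightarrow>
      runs p T s' (\<lambda>s''. frame X i s' s'' \<and> incumbent i s'' = fold f (ys k) (incumbent i s'))"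
  shows "runs (For x a p) (N * (T + 2) + 2) s (\<lambda>s'. frame (insert x X) i s s' \<and>
    incumbent i s' = fold f (concat (map ys [0..<N])) (incumbent i s))"
proof -
  define I where "I k s' \<longleftrightarrow> frame (insert x X) i s s' \<and> reg s' x = k \<and>
    incumbent i s' = fold f (concat (map ys [0..<k])) (incumbent i s)" for k s'
  have "runs (For x a p) (N * (T + 2) + 2) s (I N)"
  proof (rule runs_For)
    show "I 0 (s\<lparr>reg := (reg s)(x := 0)\<rparr>)"
      using x by (auto simp: I_def frame_def incumbent_def)
    show "reg s' x = k \<and> nval a s' = N" if "I k s'" for k s'
      using that bound by (auto simp: I_def)
    show "runs p T s' (\<lambda>s''. I (Suc k) (s''\<lparr>reg := (reg s'')(x := reg s'' x + 1)\<rparr>))"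
      if "k < N" "I k s'" for k s'
      using body[of s' k] that unfolding I_def
      apply (elim conjE)
      apply (drule meta_mp, assumption)+
      apply (erule runs_mono[OF _ order.refl])
      using x apply (auto simp: frame_def incumbent_def)
      done
  qed
  then show ?thesis by (rule runs_mono) (auto simp: I_def)
qed


text \<open>Row 2 is exempt because it is the output row; limits and samples are never
  overwritten.\<close>

definition represents :: "nat \<Rightarrow> nat \<Rightarrow> (nat \<Rightarrow> nat \<Rightarrow> real) \<Rightarrow> ram_state \<Rightarrow> bool" where
  "represents n m c s \<longleftrightarrow> reg s 0 = n \<and> reg s 1 = m \<and> (\<forall>r k. r \<noteq> 2 \<longrightarrow> cell s r k = c r k)"

lemma represents_frame:
  "represents n m c s \<Longrightarrow> frame X i s s' \<Longrightarrow> 0 \<notin> X \<Longrightarrow> 1 \<notin> X \<Longrightarrow> represents n m c s'"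
  by (auto simp: represents_def frame_def)

lemma bval_crosses_exp:
  "bval (crosses_exp l u x y) s \<longleftrightarrow> crosses (rval l s) (rval u s) (rval x s) (rval y s) = 1"
  by (auto simp: crosses_def not_less)

lemma bval_feasible_exp:
  "bval (feasible_exp l u y) s \<longleftrightarrow> feasible (rval l s) (rval u s) (rval y s)"
  by (auto simp: feasible_def)

text \<open>Registers 3 and 5 must not select row 2, on whose contents \<open>represents\<close> is
  silent. Register 9 is increased from its current value; the caller resets it. As
  \<open>count_edge\<close> takes at most 2 steps, the inner loop takes
  \<open>n * 4 + 2\<close>.\<close>

lemma runs_count_samples:
  assumes s: "represents n m c s"
    and rows: "reg s 3 \<noteq> 2" "reg s 5 \<noteq> 2"
  defines "y \<equiv> (c (reg s 3) (reg s 4) + c (reg s 5) (reg s 6)) / 2"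
  shows "runs count_samples (m * (n * 4 + 4) + 2) s (\<lambda>s'.
    (\<forall>x. x \<notin> {7, 8, 9} \<longrightarrow> reg s' x = reg s x) \<and> cell s' = cell s \<and>
    reg s' 9 = reg s 9 + empirical_cost n m c (reg s 2) y)"
proof -
  define i where "i = reg s 2"
  define keeps where "keeps s' \<longleftrightarrow> (\<forall>x. x \<notin> {7, 8, 9} \<longrightarrow> reg s' x = reg s x) \<and> cell s' = cell s"
    for s' :: ram_state
  define I where "I j s' \<longleftrightarrow> keeps s' \<and> reg s' 7 = j \<and>
    reg s' 9 = reg s 9 + (\<Sum>j'<j. edge_cost n (c 0) (c 1) i (c (j' + 3) i) y)" for j s'
  have "runs count_samples (m * ((n * (2 + 2) + 2) + 2) + 2) s (I m)"
    unfolding count_samples_def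
  proof (rule runs_For)
    show "I 0 (s\<lparr>reg := (reg s)(7 := 0)\<rparr>)" by (simp add: I_def keeps_def)
    show "reg s' 7 = j \<and> nval (NReg 1) s' = m" if "I j s'" for j s'
      using that s by (simp add: I_def keeps_def represents_def)
    show "runs (For 8 (NReg 0) count_edge) (n * (2 + 2) + 2) s'
        (\<lambda>s''. I (Suc j) (s''\<lparr>reg := (reg s'')(7 := reg s'' 7 + 1)\<rparr>))"
      if "j < m" and Ij: "I j s'" for j s'
    proof -
      \<comment> \<open>The inner sum is counted from the value that register 9 has when this sample
        is begun, so it can be appended to the outer sum.\<close>
      define J where "J k s'' \<longleftrightarrow> keeps s'' \<and> reg s'' 7 = j \<and> reg s'' 8 = k \<and> reg s'' 9 = reg s' 9 +
        (\<Sum>k'<k. if k' \<noteq> i then crosses (c 0 k') (c 1 k') (c (j + 3) i) y else 0)" for k s''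
      have "runs (For 8 (NReg 0) count_edge) (n * (2 + 2) + 2) s' (J n)"
      proof (rule runs_For)
        show "J 0 (s'\<lparr>reg := (reg s')(8 := 0)\<rparr>)" using Ij by (simp add: I_def J_def keeps_def)
        show "reg s'' 8 = k \<and> nval (NReg 0) s'' = n" if "J k s''" for k s''
          using that s by (simp add: J_def keeps_def represents_def)
        show "runs count_edge 2 s''
            (\<lambda>s''. J (Suc k) (s''\<lparr>reg := (reg s'')(8 := reg s'' 8 + 1)\<rparr>))"
          if "k < n" and Jk: "J k s''" for k s''
        proof -
          let ?b = "BAnd (BOr (NLess (NReg 8) (NReg 2)) (NLess (NReg 2) (NReg 8)))
            (crosses_exp (RCell (NConst 0) (NReg 8)) (RCell (NConst 1) (NReg 8))
              (RCell (NPlus (NReg 7) (NConst 3)) (NReg 2)) candidate_exp)"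
          have regs: "reg s'' 2 = i" "reg s'' 3 = reg s 3" "reg s'' 4 = reg s 4"
            "reg s'' 5 = reg s 5" "reg s'' 6 = reg s 6" "reg s'' 7 = j" "reg s'' 8 = k"
            using Jk by (simp_all add: J_def keeps_def i_def)
          have cells: "cell s'' r k' = c r k'" if "r \<noteq> 2" for r k'
            using Jk s that by (simp add: J_def keeps_def represents_def)
          have y: "rval candidate_exp s'' = y"
            using rows by (simp add: regs cells y_def)
          have b: "bval ?b s'' \<longleftrightarrow> k \<noteq> i \<and> crosses (c 0 k) (c 1 k) (c (j + 3) i) y = 1"
            by (subst bval.simps(4), subst bval_crosses_exp, subst y) (auto simp: regs cells)
          have val: "crosses l u x y = 0 \<or> crosses l u x y = 1" for l u x y
            by (simp add: crosses_def)
          have "runs count_edge (1 + 1) s''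
              (\<lambda>s''. J (Suc k) (s''\<lparr>reg := (reg s'')(8 := reg s'' 8 + 1)\<rparr>))"
            unfolding count_edge_def
          proof (rule runs_If)
            assume "bval ?b s''"
            then show "runs (NAssign 9 (NPlus (NReg 9) (NConst 1))) 1 s''
                (\<lambda>s''. J (Suc k) (s''\<lparr>reg := (reg s'')(8 := reg s'' 8 + 1)\<rparr>))"
              unfolding b using Jk by (intro runs_NAssign) (simp add: J_def keeps_def)
          next
            assume "\<not> bval ?b s''"
            then show "runs Skip 1 s''
                (\<lambda>s''. J (Suc k) (s''\<lparr>reg := (reg s'')(8 := reg s'' 8 + 1)\<rparr>))"
              unfolding b using Jk val by (intro runs_Skip) (auto simp: J_def keeps_def)
          qed
          then show ?thesis by (simp only: one_add_one)
        qed
      qed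
      then show ?thesis
      proof (rule runs_mono)
        fix s'' assume "J n s''"
        then show "I (Suc j) (s''\<lparr>reg := (reg s'')(7 := reg s'' 7 + 1)\<rparr>)"
          using Ij by (simp add: I_def J_def keeps_def edge_cost_def del: One_nat_def)
      qed simp
    qed
  qed
  then show ?thesis
    by (rule runs_mono) (auto simp: I_def keeps_def empirical_cost_def i_def algebra_simps)
qed

text \<open>The cost is counted before feasibility is tested; an infeasible candidate merely leaves
  the incumbent alone. The 6 consists of 1 for the reset, 2 of loop overhead and 3 for the test with
  two assignments.\<close>

lemma runs_try_candidate:
  assumes s: "represents n m c s" and i: "reg s 2 = i" and rows: "reg s 3 < 2" "reg s 5 < 2"
  defines "y \<equiv> (c (reg s 3) (reg s 4) + c (reg s 5) (reg s 6)) / 2"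
  shows "runs try_candidate (m * (n * 4 + 4) + 6) s (\<lambda>s'. frame {7, 8, 9, 10} i s s' \<and>
    incumbent i s' =
      fold (improve (feasible (c 0 i) (c 1 i)) (empirical_cost n m c i)) [y] (incumbent i s))"
    (is "runs _ _ _ ?Q")
proof -
  let ?s = "s\<lparr>reg := (reg s)(9 := 0)\<rparr>"
  let ?b = "BAnd (feasible_exp (RCell (NConst 0) (NReg 2)) (RCell (NConst 1) (NReg 2)) candidate_exp)
            (BOr (NLess (NReg 10) (NConst 1)) (NLess (NPlus (NReg 9) (NConst 1)) (NReg 10)))"
  let ?p = "Seq (NAssign 10 (NPlus (NReg 9) (NConst 1))) (RAssign (NConst 2) (NReg 2) candidate_exp)"
  have count: "runs count_samples (m * (n * 4 + 4) + 2) ?s (\<lambda>s'.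
      (\<forall>x. x \<notin> {7, 8, 9} \<longrightarrow> reg s' x = reg s x) \<and> cell s' = cell s \<and>
      reg s' 9 = empirical_cost n m c i y)"
    using runs_count_samples[of n m c ?s] s i rows by (simp add: represents_def y_def)
  have select: "runs (If ?b ?p Skip) 3 s' ?Q"
    if regs: "\<forall>x. x \<notin> {7, 8, 9} \<longrightarrow> reg s' x = reg s x" and cells: "cell s' = cell s"
      and cost: "reg s' 9 = empirical_cost n m c i y" for s'
  proof -
    have c: "cell s r k = c r k" if "r < 2" for r k
      using s that by (simp add: represents_def)
    have y: "rval candidate_exp s' = y"
      using regs rows by (simp add: cells c y_def)
    have b: "bval ?b s' \<longleftrightarrow> feasible (c 0 i) (c 1 i) y \<and>
        (reg s 10 = 0 \<or> empirical_cost n m c i y + 1 < reg s 10)"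
      using regs cost i by (subst bval.simps(4), subst bval_feasible_exp, subst y) (auto simp: cells c)
    have "runs (If ?b ?p Skip) ((1 + 1) + 1) s' ?Q"
    proof (rule runs_If)
      assume "bval ?b s'"
      then show "runs ?p (1 + 1) s' ?Q"
        unfolding b using regs cells cost i rows c
        by (intro runs_Seq runs_NAssign runs_RAssign)
          (auto simp: frame_def incumbent_def improve_def y_def)
    next
      assume "\<not> bval ?b s'"
      then have "runs Skip 1 s' ?Q"
        unfolding b using regs cells
        by (intro runs_Skip) (auto simp: frame_def incumbent_def improve_def)
      then show "runs Skip (1 + 1) s' ?Q" by (rule runs_mono) auto
    qed
    then show ?thesis by (simp add: numeral_3_eq_3)
  qed
  have "runs try_candidate (1 + ((m * (n * 4 + 4) + 2) + 3)) s ?Q"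
    unfolding try_candidate_def
    apply (intro runs_Seq runs_NAssign)
    apply (simp only: nval.simps)
    apply (rule runs_mono[OF count order.refl])
    using select by auto
  then show ?thesis by (rule runs_mono) auto
qed

text \<open>The bound of \<open>runs_For_fold\<close> nested four times, left unexpanded so that it
  fits the rule at every level.\<close>

definition search_time :: "nat \<Rightarrow> nat \<Rightarrow> nat" where
  "search_time n m =
     2 * ((n * ((2 * ((n * ((m * (n * 4 + 4) + 6) + 2) + 2) + 2) + 2) + 2) + 2) + 2) + 2"

text \<open>Each level passes the outer counters down; they survive because the inner frames omit
  their registers. \<open>r < 2\<close> and \<open>r' < 2\<close> keep the addressed rows away from
  the output row.\<close>

lemma runs_search:
  assumes s: "represents n m c s" and i: "reg s 2 = i"
  shows "runs (For 3 (NConst 2) (For 4 (NReg 0) (For 5 (NConst 2) (For 6 (NReg 0) try_candidate))))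
    (search_time n m) s (\<lambda>s'. frame {3, 4, 5, 6, 7, 8, 9, 10} i s s' \<and>
    incumbent i s' = fold (improve (feasible (c 0 i) (c 1 i)) (empirical_cost n m c i))
      (candidates n c) (incumbent i s))"
  unfolding search_time_def candidates_def
proof (rule runs_For_fold)
  fix s1 r assume s1: "frame {3, 4, 5, 6, 7, 8, 9, 10} i s s1" "reg s1 3 = r" "r < 2"
  then have c1: "represents n m c s1" "reg s1 2 = i"
    using represents_frame[OF s s1(1)] i by (auto simp: frame_def)
  show "runs (For 4 (NReg 0) (For 5 (NConst 2) (For 6 (NReg 0) try_candidate)))
     (n * ((2 * ((n * ((m * (n * 4 + 4) + 6) + 2) + 2) + 2) + 2) + 2) + 2) s1
     (\<lambda>s''. frame {4, 5, 6, 7, 8, 9, 10} i s1 s'' \<and>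
       incumbent i s'' = fold (improve (feasible (c 0 i) (c 1 i)) (empirical_cost n m c i))
         (concat (map (\<lambda>k. concat (map (\<lambda>r'. concat (map (\<lambda>k'.
           [(c r k + c r' k') / 2]) [0..<n])) [0..<2])) [0..<n])) (incumbent i s1))"
  proof (rule runs_For_fold)
    show "nval (NReg 0) s' = n" if "frame {4, 5, 6, 7, 8, 9, 10} i s1 s'" for s'
      using represents_frame[OF c1(1) that] by (simp add: represents_def)
    fix s2 k assume s2: "frame {4, 5, 6, 7, 8, 9, 10} i s1 s2" "reg s2 4 = k" "k < n"
    then have c2: "represents n m c s2" "reg s2 2 = i" "reg s2 3 = r"
      using represents_frame[OF c1(1) s2(1)] c1 s1 by (auto simp: frame_def)
    show "runs (For 5 (NConst 2) (For 6 (NReg 0) try_candidate))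
       (2 * ((n * ((m * (n * 4 + 4) + 6) + 2) + 2) + 2) + 2) s2
       (\<lambda>s''. frame {5, 6, 7, 8, 9, 10} i s2 s'' \<and>
         incumbent i s'' = fold (improve (feasible (c 0 i) (c 1 i)) (empirical_cost n m c i))
           (concat (map (\<lambda>r'. concat (map (\<lambda>k'.
             [(c r k + c r' k') / 2]) [0..<n])) [0..<2])) (incumbent i s2))"
    proof (rule runs_For_fold)
      fix s3 r' assume s3: "frame {5, 6, 7, 8, 9, 10} i s2 s3" "reg s3 5 = r'" "r' < 2"
      then have c3: "represents n m c s3" "reg s3 2 = i" "reg s3 3 = r" "reg s3 4 = k"
        using represents_frame[OF c2(1) s3(1)] c2 s2 by (auto simp: frame_def)
      show "runs (For 6 (NReg 0) try_candidate)
         (n * ((m * (n * 4 + 4) + 6) + 2) + 2) s3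
         (\<lambda>s''. frame {6, 7, 8, 9, 10} i s3 s'' \<and>
           incumbent i s'' = fold (improve (feasible (c 0 i) (c 1 i)) (empirical_cost n m c i))
             (concat (map (\<lambda>k'. [(c r k + c r' k') / 2]) [0..<n])) (incumbent i s3))"
      proof (rule runs_For_fold)
        show "nval (NReg 0) s' = n" if "frame {6, 7, 8, 9, 10} i s3 s'" for s'
          using represents_frame[OF c3(1) that] by (simp add: represents_def)
        fix s4 k' assume s4: "frame {6, 7, 8, 9, 10} i s3 s4" "reg s4 6 = k'" "k' < n"
        then have c4: "represents n m c s4" "reg s4 2 = i" "reg s4 3 = r" "reg s4 4 = k" "reg s4 5 = r'"
          using represents_frame[OF c3(1) s4(1)] c3 s3 by (auto simp: frame_def)
        show "runs try_candidate (m * (n * 4 + 4) + 6) s4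
           (\<lambda>s''. frame {7, 8, 9, 10} i s4 s'' \<and>
             incumbent i s'' = fold (improve (feasible (c 0 i) (c 1 i)) (empirical_cost n m c i))
               [(c r k + c r' k') / 2] (incumbent i s4))"
          using runs_try_candidate[OF c4(1,2)] c4 s1(3) s3(3) s4(2) by simp
      qed simp_all
    qed simp_all
  qed simp_all
qed simp_all

text \<open>Every search must start from the incumbent \<open>(0, 0)\<close>, as in
  \<open>erm\<close>. Hence \<open>zero\<close>, and hence the invariant records that the output
  cells from \<open>k\<close> on are still 0.\<close>

lemma runs_erm_program:
  assumes s: "represents n m c s" and zero: "\<And>k. cell s 2 k = 0"
  shows "runs erm_program (n * (search_time n m + 3) + 2) s (\<lambda>s'. \<forall>k<n. cell s' 2 k = erm n m c k)"
proof -
  define I where "I k s' \<longleftrightarrow> represents n m c s' \<and> reg s' 2 = k \<and>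
    (\<forall>k'. cell s' 2 k' = (if k' < k then erm n m c k' else 0))" for k s'
  have "runs erm_program (n * ((1 + search_time n m) + 2) + 2) s (I n)"
    unfolding erm_program_def
  proof (rule runs_For)
    show "I 0 (s\<lparr>reg := (reg s)(2 := 0)\<rparr>)"
      using s zero by (simp add: I_def represents_def)
    show "reg s' 2 = k \<and> nval (NReg 0) s' = n" if "I k s'" for k s'
      using that by (simp add: I_def represents_def)
    fix k s' assume "k < n" and Ik: "I k s'"
    let ?s = "s'\<lparr>reg := (reg s')(10 := 0)\<rparr>"
    have s': "represents n m c ?s" "reg ?s 2 = k" "incumbent k ?s = (0, 0)"
      using Ik by (auto simp: I_def represents_def incumbent_def)
    show "runs (Seq (NAssign 10 (NConst 0)) (For 3 (NConst 2) (For 4 (NReg 0)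
        (For 5 (NConst 2) (For 6 (NReg 0) try_candidate))))) (1 + search_time n m) s'
        (\<lambda>s''. I (Suc k) (s''\<lparr>reg := (reg s'')(2 := reg s'' 2 + 1)\<rparr>))"
    proof (intro runs_Seq runs_NAssign, unfold nval.simps,
        rule runs_mono[OF runs_search[OF s'(1,2)] order.refl], elim conjE)
      fix s'' assume fr: "frame {3, 4, 5, 6, 7, 8, 9, 10} k ?s s''"
        and inc: "incumbent k s'' = fold (improve (feasible (c 0 k) (c 1 k)) (empirical_cost n m c k))
          (candidates n c) (incumbent k ?s)"
      have "cell s'' 2 k = erm n m c k"
        using arg_cong[OF inc, of snd] unfolding s'(3) by (simp add: erm_def incumbent_def)
      then show "I (Suc k) (s''\<lparr>reg := (reg s'')(2 := reg s'' 2 + 1)\<rparr>)"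
        using fr Ik represents_frame[OF s'(1) fr]
        by (auto simp: I_def frame_def represents_def less_Suc_eq)
    qed
  qed
  then show ?thesis by (rule runs_mono) (auto simp: I_def algebra_simps)
qed

section \<open>Polynomial running time\<close>

lemma loop_time:
  fixes q :: nat
  assumes "N \<le> q" "T \<le> a * q ^ d" "1 \<le> q"
  shows "N * (T + 2) + 2 \<le> (a + 4) * q ^ Suc d"
proof -
  have "1 \<le> q ^ d" using assms(3) by simp
  have "N * (T + 2) + 2 \<le> q * (a * q ^ d + 2 * q ^ d) + 2 * (q * q ^ d)"
    using assms \<open>1 \<le> q ^ d\<close> by (intro add_mono mult_mono) auto
  then show ?thesis by (simp add: algebra_simps)
qed

lemma double_loop_time:
  fixes q :: nat
  assumes "T \<le> a * q ^ d" "1 \<le> q"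
  shows "2 * (T + 2) + 2 \<le> (2 * a + 6) * q ^ d"
proof -
  have "1 \<le> q ^ d" using assms(2) by simp
  then show ?thesis using assms(1) by (simp add: algebra_simps)
qed

text \<open>The sample loop and the edge loop inside it give degree 2; the two loops over the
  indices of limits and the loop over predicted edges add one each. Loops of two rounds only change
  the constants, which run through 14, 18, 42, 46, 98, then 99 for the reset of register 10, and
  103.\<close>

lemma program_time: "n * (search_time n m + 3) + 2 \<le> 103 * (m + n + 1) ^ 5"
proof -
  define q where "q = m + n + 1"
  have q: "n \<le> q" "m \<le> q" "1 \<le> q" by (auto simp: q_def)
  have "m * (n * 4 + 4) + 6 \<le> q * (q * 4 + 4 * q) + 6 * (q * q)"
    using q by (intro add_mono mult_mono) auto
  then have "m * (n * 4 + 4) + 6 \<le> 14 * q ^ 2" by (simp add: power2_eq_square algebra_simps)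
  from loop_time[OF q(1) this q(3)]
  have "n * (m * (n * 4 + 4) + 6 + 2) + 2 \<le> 18 * q ^ Suc 2" by simp
  from double_loop_time[OF this q(3)]
  have "2 * (n * (m * (n * 4 + 4) + 6 + 2) + 2 + 2) + 2 \<le> 42 * q ^ Suc 2" by simp
  from loop_time[OF q(1) this q(3)]
  have "n * (2 * (n * (m * (n * 4 + 4) + 6 + 2) + 2 + 2) + 2 + 2) + 2 \<le> 46 * q ^ Suc (Suc 2)" by simp
  from double_loop_time[OF this q(3)]
  have "search_time n m \<le> 98 * q ^ Suc (Suc 2)" unfolding search_time_def by simp
  moreover have "1 \<le> q ^ Suc (Suc 2)" using q by simp
  ultimately have "search_time n m + 1 \<le> 99 * q ^ Suc (Suc 2)" by linarith
  from loop_time[OF q(1) this q(3)]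
  have "n * (search_time n m + 1 + 2) + 2 \<le> 103 * q ^ Suc (Suc (Suc 2))" by simp
  moreover have "Suc (Suc (Suc 2)) = (5::nat)" "search_time n m + 1 + 2 = search_time n m + 3" by simp_all
  ultimately show ?thesis unfolding q_def by metis
qed

section \<open>The learner as a function on edges, and its computation\<close>

definition learner ::
  "'e set \<Rightarrow> (nat \<Rightarrow> 'e) \<Rightarrow> ('e \<Rightarrow> real) \<Rightarrow> ('e \<Rightarrow> real) \<Rightarrow> nat \<Rightarrow> (nat \<Rightarrow> 'e \<Rightarrow> real) \<Rightarrow> 'e \<Rightarrow> real" where
  "learner E enum L U m S =
     (\<lambda>e\<in>E. erm (card E) m (cell (initial_state E enum L U m S)) (inv_into {..<card E} enum e))"

lemma ball_enum: "bij_betw f {..<N} E \<Longrightarrow> (\<forall>e\<in>E. P e) \<longleftrightarrow> (\<forall>i<N. P (f i))"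
  by (auto simp: bij_betw_def)

lemma learner_enum:
  assumes "bij_betw enum {..<card E} E" "i < card E"
  shows "learner E enum L U m S (enum i) = erm (card E) m (cell (initial_state E enum L U m S)) i"
  using assms bij_betwE[OF assms(1)]
  by (simp add: learner_def bij_betw_inv_into_left[OF assms(1)])

lemma learner_in_predictions:
  assumes enum: "bij_betw enum {..<card E} E" and le: "\<And>e. e \<in> E \<Longrightarrow> L e \<le> U e"
  shows "learner E enum L U m S \<in> predictions E L U"
proof -
  have "learner E enum L U m S (enum i) \<in> ival L U (enum i)" if i: "i < card E" for i
  proof -
    let ?c = "cell (initial_state E enum L U m S)"
    have c: "?c 0 i = L (enum i)" "?c 1 i = U (enum i)"
      using i by (simp_all add: initial_state_def)
    have "L (enum i) \<le> U (enum i)" using le i bij_betwE[OF enum] by blast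
    then have "feasible (L (enum i)) (U (enum i)) (erm (card E) m ?c i)"
      using erm_optimal(1)[of i "card E" ?c m] i unfolding c by blast
    then show ?thesis by (simp add: learner_enum[OF enum i] feasible_def ival_def)
  qed
  then have "\<forall>e\<in>E. learner E enum L U m S e \<in> ival L U e"
    by (simp add: ball_enum[OF enum])
  then show ?thesis by (auto simp: predictions_def learner_def)
qed

lemma computes_learner:
  assumes "bij_betw enum {..<card E} E"
  shows "\<exists>t\<le>103 * (m + card E + 1) ^ 5.
    computes erm_program E enum L U m S (learner E enum L U m S) t"
proof -
  let ?s = "initial_state E enum L U m S"
  have "represents (card E) m (cell ?s) ?s" by (simp add: represents_def initial_state_def)
  moreover have "cell ?s 2 k = 0" for k by (simp add: initial_state_def)
  ultimately have "runs erm_program (103 * (m + card E + 1) ^ 5) ?s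
      (\<lambda>s'. \<forall>k<card E. cell s' 2 k = erm (card E) m (cell ?s) k)"
    by (intro runs_mono[OF runs_erm_program program_time]) auto
  then show ?thesis
    by (auto simp: runs_def computes_def learner_enum[OF assms])
qed

section \<open>Generalisation bound\<close>

lemma sample_sum_deviation:
  fixes f :: "'a \<Rightarrow> real"
  assumes D: "prob_space D" and f [measurable]: "f \<in> borel_measurable D"
    and bounds: "\<And>x. x \<in> space D \<Longrightarrow> 0 \<le> f x \<and> f x \<le> b"
    and "b > 0" "m > 0" "t \<ge> 0"
  shows "measure (\<Pi>\<^sub>M j\<in>{..<m}. D)
      {S \<in> space (\<Pi>\<^sub>M j\<in>{..<m}. D). m * t \<le> \<bar>(\<Sum>j<m. f (S j)) - m * (\<integral>x. f x \<partial>D)\<bar>}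
    \<le> 2 * exp (- 2 * real m * t\<^sup>2 / b\<^sup>2)"
proof -
  let ?P = "\<Pi>\<^sub>M j\<in>{..<m}. D"
  interpret P: prob_space ?P by (intro prob_space_PiM D)
  have comp: "distr ?P D (\<lambda>S. S j) = D" if "j < m" for j
    using distr_PiM_component[of "{..<m}" "\<lambda>_. D" j] D that by simp
  have "P.indep_vars (\<lambda>_. D) (\<lambda>j S. S j) {..<m}"
  proof (subst P.indep_vars_iff_distr_eq_PiM')
    \<comment> \<open>On the product space the restriction to \<open>{..<m}\<close> is the identity
      and each coordinate has law \<open>D\<close>, so the joint law is the product of the
      marginals.\<close>
    have "distr ?P ?P (\<lambda>S. \<lambda>j\<in>{..<m}. S j) = distr ?P ?P (\<lambda>S. S)"
      by (intro distr_cong) (auto simp: space_PiM PiE_def extensional_restrict)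
    also have "\<dots> = (\<Pi>\<^sub>M j\<in>{..<m}. distr ?P D (\<lambda>S. S j))"
      by (intro trans[OF distr_id] PiM_cong) (simp_all add: comp)
    finally show "distr ?P ?P (\<lambda>S. \<lambda>j\<in>{..<m}. S j) = (\<Pi>\<^sub>M j\<in>{..<m}. distr ?P D (\<lambda>S. S j))" .
  qed (use \<open>m > 0\<close> in auto)
  then have indep: "P.indep_vars (\<lambda>_. borel) (\<lambda>j S. f (S j)) {..<m}"
    by (rule P.indep_vars_compose2) simp
  have mean: "P.expectation (\<lambda>S. f (S j)) = (\<integral>x. f x \<partial>D)" if "j < m" for j
    using integral_distr[of "\<lambda>S. S j" ?P D f] that comp[OF that] by simp
  have range: "AE S in ?P. f (S j) \<in> {0..b}" if "j \<in> {..<m}" for j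
    using bounds that by (intro AE_I2) (auto simp: space_PiM PiE_def Pi_def)
  interpret Hoeffding_ineq ?P "{..<m}" "\<lambda>j S. f (S j)" "\<lambda>_. 0" "\<lambda>_. b"
    "\<Sum>j<m. P.expectation (\<lambda>S. f (S j))"
    by unfold_locales (use indep range in simp_all)
  have "P.prob {S \<in> space ?P. m * t \<le> \<bar>(\<Sum>j<m. f (S j)) - (\<Sum>j<m. P.expectation (\<lambda>S. f (S j)))\<bar>}
      \<le> 2 * exp (- 2 * (m * t)\<^sup>2 / (\<Sum>j<m. (b - 0)\<^sup>2))"
    by (intro Hoeffding_ineq_abs_ge) (use assms in auto)
  \<comment> \<open>The squared ranges add up to \<open>m\<close> times the square of
    \<open>b\<close>, cancelling one factor \<open>m\<close>.\<close>
  moreover have "- 2 * (m * t)\<^sup>2 / (\<Sum>j<m. (b - 0)\<^sup>2) = - 2 * real m * t\<^sup>2 / b\<^sup>2"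
    using \<open>m > 0\<close> \<open>b > 0\<close> by (simp add: power2_eq_square field_simps)
  ultimately show ?thesis by (simp add: mean)
qed

section \<open>Measurability of costs and of the search\<close>

lemma crosses_measurable [measurable]: "(\<lambda>x. crosses l u x y) \<in> borel \<rightarrow>\<^sub>M count_space UNIV"
proof -
  have "(\<lambda>x. crosses l u x y) = (\<lambda>x. if (x \<le> l \<and> y \<le> l) \<or> (l < x \<and> x < u \<and> l < y \<and> y < u) \<or>
      (u \<le> x \<and> u \<le> y) then 0 else 1)"
    by (auto simp: crosses_def)
  then show ?thesis by simp
qed

lemma edge_cost_measurable [measurable]:
  "(\<lambda>x. real (edge_cost n l u i x y)) \<in> borel_measurable borel"
proof -
  have "(\<lambda>x. real (edge_cost n l u i x y)) =
      (\<lambda>x. \<Sum>k<n. if k \<noteq> i then real (crosses (l k) (u k) x y) else 0)"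
    by (auto simp: edge_cost_def intro!: sum.cong)
  then show ?thesis by simp
qed

text \<open>The list does not depend on \<open>x\<close>, so the result is a decision tree over
  countably many cost values with finitely many possible points. This allows the discrete
  sigma-algebra even on the real component.\<close>

lemma measurable_fold_improve:
  assumes "\<And>y. y \<in> set ys \<Longrightarrow> (\<lambda>x. f x y) \<in> M \<rightarrow>\<^sub>M count_space UNIV"
  shows "(\<lambda>x. fold (improve P (f x)) ys (b, v)) \<in> M \<rightarrow>\<^sub>M count_space UNIV"
  using assms
proof (induction ys rule: rev_induct)
  case Nil
  then show ?case by simp
next
  case (snoc y ys)
  define g where "g x = fold (improve P (f x)) ys (b, v)" for x
  have g: "g \<in> M \<rightarrow>\<^sub>M count_space UNIV"
    unfolding g_def using snoc by simp
  define h where "h x = fst (g x)" for x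
  have [measurable]: "h \<in> M \<rightarrow>\<^sub>M count_space UNIV"
    unfolding h_def by (rule measurable_compose[OF g]) simp
  have fy [measurable]: "(\<lambda>x. f x y) \<in> M \<rightarrow>\<^sub>M count_space UNIV"
    using snoc.prems by simp
  have new: "(\<lambda>x. (f x y + 1, y)) \<in> M \<rightarrow>\<^sub>M count_space UNIV"
    by (rule measurable_compose[OF fy]) simp
  have better: "f x y + 1 < h x \<longleftrightarrow> real (f x y) + 1 < real (h x)" for x
    by linarith
  have "(\<lambda>x. if P y \<and> (h x = 0 \<or> f x y + 1 < h x) then (f x y + 1, y) else g x)
      \<in> M \<rightarrow>\<^sub>M count_space UNIV"
    by (rule measurable_If[OF new g], unfold better) measurable
  moreover have "fold (improve P (f x)) (ys @ [y]) (b, v) =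
      (if P y \<and> (h x = 0 \<or> f x y + 1 < h x) then (f x y + 1, y) else g x)" for x
    by (cases "g x") (auto simp: g_def[symmetric] h_def improve_def[of _ _ y])
  ultimately show ?case by simp
qed

section \<open>A fixed instance: expected cost as a sum of risks of single edges\<close>

locale learning_instance =
  fixes E :: "'e set" and enum :: "nat \<Rightarrow> 'e" and L U :: "'e \<Rightarrow> real"
    and D :: "('e \<Rightarrow> real) measure"
  assumes finite_E: "finite E" and L_le_U: "\<And>e. e \<in> E \<Longrightarrow> L e \<le> U e"
    and enum: "bij_betw enum {..<card E} E" and distribution: "value_distribution E L U D"
begin

sublocale prob_space D
  using distribution by (simp add: value_distribution_def)

abbreviation n :: nat where "n \<equiv> card E"

text \<open>Rows 0 and 1 of the memory, which do not depend on the samples.\<close>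

definition limits :: "nat \<Rightarrow> nat \<Rightarrow> real" where
  "limits = cell (initial_state E enum L U 0 (\<lambda>_ _. 0))"

definition cost :: "nat \<Rightarrow> real \<Rightarrow> real \<Rightarrow> nat" where
  "cost = edge_cost n (limits 0) (limits 1)"

definition risk :: "nat \<Rightarrow> real \<Rightarrow> real" where
  "risk i y = (\<integral>w. real (cost i (w (enum i)) y) \<partial>D)"

abbreviation admissible :: "nat \<Rightarrow> real \<Rightarrow> bool" where
  "admissible i \<equiv> feasible (limits 0 i) (limits 1 i)"

lemma limits_row: "r < 2 \<Longrightarrow> cell (initial_state E enum L U m S) r = limits r"
  by (auto simp: limits_def initial_state_def fun_eq_iff)

lemma limits_rows:
  "cell (initial_state E enum L U m S) 0 = limits 0"
  "cell (initial_state E enum L U m S) 1 = limits 1"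
  by (simp_all only: limits_row)

lemma limits_eq: "i < n \<Longrightarrow> limits 0 i = L (enum i)" "i < n \<Longrightarrow> limits 1 i = U (enum i)"
  by (simp_all add: limits_def initial_state_def)

lemma enum_in: "i < n \<Longrightarrow> enum i \<in> E"
  using bij_betwE[OF enum] by blast

lemma limits_le: "i < n \<Longrightarrow> limits 0 i \<le> limits 1 i"
  by (simp only: limits_eq L_le_U enum_in)

lemma admissible_iff: "i < n \<Longrightarrow> admissible i y \<longleftrightarrow> y \<in> ival L U (enum i)"
  by (simp only: limits_eq) (simp add: feasible_def ival_def)

lemma predictions_iff:
  "p \<in> predictions E L U \<longleftrightarrow> p \<in> extensional E \<and> (\<forall>i<n. admissible i (p (enum i)))"
proof -
  have "(\<forall>e\<in>E. p e \<in> ival L U e) \<longleftrightarrow> (\<forall>i<n. p (enum i) \<in> ival L U (enum i))"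
    by (simp add: ball_enum[OF enum])
  then show ?thesis
    by (auto simp: predictions_def PiE_def Pi_def admissible_iff simp del: One_nat_def)
qed

text \<open>Each summand involves a single coordinate of \<open>w\<close> and of \<open>p\<close>,
  which is what lets the edges be optimised independently. Injectivity of \<open>enum\<close> turns
  distinct edges into distinct indices.\<close>

lemma hop_distance_eq: "hop_distance E L U w p = (\<Sum>i<n. cost i (w (enum i)) (p (enum i)))"
proof -
  have inner: "(\<Sum>e'\<in>E - {enum i}. crosses (L e') (U e') x y) = cost i x y" if "i < n" for i x y
  proof -
    have "(\<Sum>e'\<in>E - {enum i}. crosses (L e') (U e') x y) =
        (\<Sum>e'\<in>E. if e' \<noteq> enum i then crosses (L e') (U e') x y else 0)"
      using finite_E by (intro sum.mono_neutral_cong_left) auto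
    also have "\<dots> = (\<Sum>k<n. if enum k \<noteq> enum i then crosses (L (enum k)) (U (enum k)) x y else 0)"
      by (rule sum.reindex_bij_betw[OF enum, symmetric])
    also have "\<dots> = cost i x y"
      unfolding cost_def edge_cost_def using that bij_betw_imp_inj_on[OF enum]
      by (intro sum.cong refl) (auto simp: limits_eq limits_eq[simplified] inj_on_eq_iff)
    finally show ?thesis .
  qed
  have "hop_distance E L U w p =
      (\<Sum>i<n. \<Sum>e'\<in>E - {enum i}. crosses (L e') (U e') (w (enum i)) (p (enum i)))"
    unfolding hop_distance_def by (rule sum.reindex_bij_betw[OF enum, symmetric])
  then show ?thesis by (simp add: inner)
qed

lemma coordinate_measurable:
  assumes "i < n"
  shows "(\<lambda>w. w (enum i)) \<in> borel_measurable D"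
proof -
  have "(\<lambda>w. w (enum i)) \<in> D \<rightarrow>\<^sub>M restrict_space borel (ival L U (enum i))"
    using distribution enum_in[OF assms] measurable_component_singleton[of "enum i" E]
    unfolding value_distribution_def by (simp cong: measurable_cong_sets)
  moreover have "(\<lambda>x. x) \<in> restrict_space borel (ival L U (enum i)) \<rightarrow>\<^sub>M borel"
    by (intro measurable_restrict_space1) simp
  ultimately show ?thesis by (rule measurable_compose)
qed

lemma cost_measurable: "i < n \<Longrightarrow> (\<lambda>w. real (cost i (w (enum i)) y)) \<in> borel_measurable D"
  unfolding cost_def by (rule measurable_compose[OF coordinate_measurable edge_cost_measurable])

lemma cost_le: "cost i x y \<le> n"
  by (simp add: cost_def edge_cost_le)

lemma expected_hop_eq: "expected_hop E L U D p = (\<Sum>i<n. risk i (p (enum i)))"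
proof -
  have "integrable D (\<lambda>w. real (cost i (w (enum i)) y))" if "i < n" for i y
    using cost_le by (intro integrable_const_bound[of _ n] cost_measurable that) auto
  then show ?thesis
    unfolding expected_hop_def hop_distance_eq risk_def by simp
qed

abbreviation grid :: "real list" where "grid \<equiv> candidates n limits"

text \<open>Only rows 0 and 1 enter, and they carry no sample data; the union bound over
  \<open>grid\<close> rests on this.\<close>

lemma candidates_initial_state: "candidates n (cell (initial_state E enum L U m S)) = grid"
  by (simp add: candidates_def limits_row upt_rec numeral_2_eq_2 limits_row[of "Suc 0", simplified])

text \<open>An admissible value shares its cost, for all true values, with an admissible grid point,
  hence also its risk. This serves both the existence of an optimum and the comparison of the
  learner with arbitrary predictions.\<close>

lemma risk_bound_from_grid:
  assumes "i < n" and "\<And>y. y \<in> set grid \<Longrightarrow> admissible i y \<Longrightarrow> a \<le> risk i y" and "admissible i y"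
  shows "a \<le> risk i y"
proof -
  obtain z where "z \<in> set grid" "admissible i z" "\<And>x. cost i x z = cost i x y"
    using candidate_same_cost[where c = limits, OF assms(1,3)] unfolding cost_def by blast
  then show ?thesis using assms(2)[of z] by (simp add: risk_def)
qed

text \<open>On an open interval a minimum is not automatic; here the minimum over the finitely many
  admissible grid points is a global one.\<close>

lemma optimal_prediction:
  obtains p where "p \<in> predictions E L U"
    and "\<And>i y. i < n \<Longrightarrow> admissible i y \<Longrightarrow> risk i (p (enum i)) \<le> risk i y"
proof -
  have "\<exists>z. admissible i z \<and> (\<forall>y. admissible i y \<longrightarrow> risk i z \<le> risk i y)" if i: "i < n" for i
  proof -
    define Z where "Z = {z \<in> set grid. admissible i z}"
    have "finite Z" by (simp add: Z_def)
    moreover have "Z \<noteq> {}"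
      using candidate_same_cost[where c = limits, OF i feasible_midpoint[OF limits_le[OF i]]] by (auto simp: Z_def)
    ultimately obtain z where "z \<in> Z" "\<And>y. y \<in> Z \<Longrightarrow> risk i z \<le> risk i y"
      using arg_min_if_finite[of Z "risk i"] by (metis not_less)
    then show ?thesis
      using risk_bound_from_grid[OF i, of "risk i z"] by (auto simp: Z_def)
  qed
  then obtain z where z: "\<And>i. i < n \<Longrightarrow> admissible i (z i)"
    "\<And>i y. i < n \<Longrightarrow> admissible i y \<Longrightarrow> risk i (z i) \<le> risk i y"
    by metis
  define p where "p = (\<lambda>e\<in>E. z (inv_into {..<n} enum e))"
  have "p (enum i) = z i" if "i < n" for i
    using that enum_in by (simp add: p_def bij_betw_inv_into_left[OF enum])
  then show ?thesis using z by (intro that[of p]) (auto simp: predictions_iff p_def)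
qed

lemma optimal_is_arg_min:
  assumes "p \<in> predictions E L U"
    and "\<And>i y. i < n \<Longrightarrow> admissible i y \<Longrightarrow> risk i (p (enum i)) \<le> risk i y"
  shows "is_arg_min (expected_hop E L U D) (\<lambda>p'. p' \<in> predictions E L U) p"
  using assms unfolding is_arg_min_def expected_hop_eq
  by (auto simp: not_less predictions_iff intro!: sum_mono)

lemma empirical_cost_eq:
  assumes "i < n"
  shows "real (empirical_cost n m (cell (initial_state E enum L U m S)) i y) =
    (\<Sum>j<m. real (cost i (S j (enum i)) y))"
proof -
  have "empirical_cost n m (cell (initial_state E enum L U m S)) i y = (\<Sum>j<m. cost i (S j (enum i)) y)"
    unfolding empirical_cost_def cost_def limits_rows using assms
    by (intro sum.cong) (simp_all add: initial_state_def)
  then show ?thesis by simp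
qed

text \<open>Passing from risk to empirical cost at the learner's value and back at the competitor
  costs \<open>t\<close> each. Deviations matter on the grid only: the learner's value lies there,
  and the competitor can be moved there.\<close>

lemma learner_near_optimal:
  assumes i: "i < n" and "m > 0" and y: "admissible i y"
    and dev: "\<And>y. y \<in> set grid \<Longrightarrow>
      \<bar>(\<Sum>j<m. real (cost i (S j (enum i)) y)) - m * risk i y\<bar> < m * t"
  shows "risk i (learner E enum L U m S (enum i)) \<le> risk i y + 2 * t"
proof -
  let ?c = "cell (initial_state E enum L U m S)"
  define v where "v = learner E enum L U m S (enum i)"
  have v: "v = erm n m ?c i" by (simp add: v_def learner_enum[OF enum i])
  have "risk i v - 2 * t \<le> risk i y"
  proof (rule risk_bound_from_grid[OF i _ y])
    fix z assume z: "z \<in> set grid" "admissible i z"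
    note opt = erm_optimal[where c = ?c and m = m, OF i,
        unfolded limits_rows candidates_initial_state, OF limits_le[OF i]]
    have "real (empirical_cost n m ?c i v) \<le> real (empirical_cost n m ?c i z)"
      unfolding v using opt(3)[OF z] by simp
    then have "(\<Sum>j<m. real (cost i (S j (enum i)) v)) \<le> (\<Sum>j<m. real (cost i (S j (enum i)) z))"
      unfolding empirical_cost_eq[OF i] .
    with dev[OF z(1)] dev[OF opt(2), folded v] have "m * risk i v - m * t < m * risk i z + m * t"
      by linarith
    then have "real m * (risk i v - 2 * t) < m * risk i z" by (simp add: algebra_simps)
    then show "risk i v - 2 * t \<le> risk i z" using \<open>m > 0\<close> by simp
  qed
  then show ?thesis by (simp add: v_def)
qed

lemma sample_measurable:
  "i < n \<Longrightarrow> j < m \<Longrightarrow> (\<lambda>S. real (cost i (S j (enum i)) y)) \<in> borel_measurable (\<Pi>\<^sub>M j\<in>{..<m}. D)"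
  by (rule measurable_compose[where N = D and g = "\<lambda>w. real (cost i (w (enum i)) y)"])
    (auto intro: measurable_component_singleton cost_measurable)

lemma learner_measurable:
  assumes i: "i < n"
  shows "(\<lambda>S. learner E enum L U m S (enum i)) \<in> (\<Pi>\<^sub>M j\<in>{..<m}. D) \<rightarrow>\<^sub>M count_space UNIV"
proof -
  \<comment> \<open>The floor of the real sum is the count itself, which turns Borel measurability
    into measurability for the discrete sigma-algebra.\<close>
  have "(\<lambda>S. nat \<lfloor>\<Sum>j<m. real (cost i (S j (enum i)) y)\<rfloor>)
      \<in> (\<Pi>\<^sub>M j\<in>{..<m}. D) \<rightarrow>\<^sub>M count_space UNIV" for y
    using sample_measurable[OF i] by measurable
  then have emp: "(\<lambda>S. empirical_cost n m (cell (initial_state E enum L U m S)) i y)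
      \<in> (\<Pi>\<^sub>M j\<in>{..<m}. D) \<rightarrow>\<^sub>M count_space UNIV" for y
    unfolding empirical_cost_eq[OF i, symmetric] by simp
  show ?thesis
    unfolding learner_enum[OF enum i] erm_def candidates_initial_state limits_rows
    by (rule measurable_compose[OF measurable_fold_improve[OF emp]]) simp
qed

text \<open>In \<open>m\<close>, the factor \<open>8 * real n ^ 3\<close> is \<open>n\<close> edges
  times \<open>4 * n^2\<close> candidates times the 2 of the two-sided Hoeffding bound.\<close>

lemma learner_succeeds:
  assumes p: "p \<in> predictions E L U"
    and opt: "\<And>i y. i < n \<Longrightarrow> admissible i y \<Longrightarrow> risk i (p (enum i)) \<le> risk i y"
    and "0 < \<epsilon>" "m > 0"
    and m: "8 * real n ^ 3 * exp (- 2 * real m * (\<epsilon> / (2 * n))\<^sup>2 / (real n)\<^sup>2) \<le> \<delta>"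
  shows "1 - \<delta> \<le> measure (\<Pi>\<^sub>M j\<in>{..<m}. D) {S \<in> space (\<Pi>\<^sub>M j\<in>{..<m}. D).
    expected_hop E L U D (learner E enum L U m S) \<le> expected_hop E L U D p + \<epsilon>}"
    (is "_ \<le> measure ?P ?good")
proof -
  interpret P: prob_space ?P by (intro prob_space_PiM prob_space_axioms)
  define t where "t = \<epsilon> / (2 * n)"
  define B where "B i y = {S \<in> space ?P.
    m * t \<le> \<bar>(\<Sum>j<m. real (cost i (S j (enum i)) y)) - m * risk i y\<bar>}" for i y
  have [measurable]: "i < n \<Longrightarrow> j < m \<Longrightarrow>
      (\<lambda>S. real (cost i (S j (enum i)) y)) \<in> borel_measurable ?P" for i j y
    by (rule sample_measurable)
  have B_sets: "B i y \<in> P.events" if "i < n" for i y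
    unfolding B_def using that by measurable
  have B_prob: "P.prob (B i y) \<le> 2 * exp (- 2 * real m * t\<^sup>2 / (real n)\<^sup>2)" if "i < n" for i y
    unfolding B_def risk_def using \<open>m > 0\<close> \<open>0 < \<epsilon>\<close> that
    by (intro sample_sum_deviation[where f = "\<lambda>w. real (cost i (w (enum i)) y)"])
      (auto simp: t_def cost_le prob_space_axioms intro: cost_measurable)
  let ?B = "\<Union>i\<in>{..<n}. \<Union>y\<in>set grid. B i y"
  have "P.prob ?B \<le> (\<Sum>i<n. P.prob (\<Union>y\<in>set grid. B i y))"
    using B_sets by (intro P.finite_measure_subadditive_finite) auto
  also have "\<dots> \<le> (\<Sum>i<n. \<Sum>y\<in>set grid. P.prob (B i y))"
    using B_sets by (intro sum_mono P.finite_measure_subadditive_finite) auto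
  also have "\<dots> \<le> (\<Sum>i<n. \<Sum>y\<in>set grid. 2 * exp (- 2 * real m * t\<^sup>2 / (real n)\<^sup>2))"
    by (intro sum_mono B_prob) simp
  also have "\<dots> = n * (card (set grid) * (2 * exp (- 2 * real m * t\<^sup>2 / (real n)\<^sup>2)))"
    by simp
  also have "\<dots> \<le> n * (real (4 * n\<^sup>2) * (2 * exp (- 2 * real m * t\<^sup>2 / (real n)\<^sup>2)))"
    using card_length[of grid] unfolding length_candidates
    by (intro mult_left_mono mult_right_mono) (simp_all only: of_nat_le_iff, simp_all)
  also have "\<dots> = 8 * real n ^ 3 * exp (- 2 * real m * t\<^sup>2 / (real n)\<^sup>2)"
    by (simp add: power2_eq_square power3_eq_cube)
  also have "\<dots> \<le> \<delta>" using m unfolding t_def .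
  finally have "P.prob ?B \<le> \<delta>" .
  moreover have "?B \<in> P.events" using B_sets by auto
  ultimately have "1 - \<delta> \<le> P.prob (space ?P - ?B)" by (simp add: P.prob_compl)
  also have "\<dots> \<le> P.prob ?good"
  proof (rule P.finite_measure_mono)
    show "space ?P - ?B \<subseteq> ?good"
    proof safe
      fix S assume S: "S \<in> space ?P" "S \<notin> ?B"
      have "risk i (learner E enum L U m S (enum i)) \<le> risk i (p (enum i)) + 2 * t"
        if i: "i < n" for i
      proof (rule learner_near_optimal[OF i \<open>m > 0\<close>])
        show "admissible i (p (enum i))" using p i by (simp add: predictions_iff)
        show "\<bar>(\<Sum>j<m. real (cost i (S j (enum i)) y)) - m * risk i y\<bar> < m * t"
          if "y \<in> set grid" for y
          using S that i by (auto simp: B_def not_le)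
      qed
      then have "expected_hop E L U D (learner E enum L U m S) \<le> (\<Sum>i<n. risk i (p (enum i)) + 2 * t)"
        unfolding expected_hop_eq by (intro sum_mono) simp
      \<comment> \<open>The terms \<open>2 * t\<close> add up to \<epsilon>, or to 0 if there is no
        edge.\<close>
      also have "\<dots> \<le> expected_hop E L U D p + \<epsilon>"
        using \<open>0 < \<epsilon>\<close> by (simp add: expected_hop_eq sum.distrib t_def)
      finally show "expected_hop E L U D (learner E enum L U m S) \<le> expected_hop E L U D p + \<epsilon>" .
    qed
    \<comment> \<open>Monotonicity requires the larger set to be an event. As the learner is
      measurable into the discrete sigma-algebra, \<open>risk i\<close> can be composed with it
      without being shown Borel.\<close>
    have [measurable]: "(\<lambda>S. risk i (learner E enum L U m S (enum i))) \<in> borel_measurable ?P"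
      if "i < n" for i
      by (rule measurable_compose[OF learner_measurable[OF that]]) simp
    show "?good \<in> P.events" unfolding expected_hop_eq by measurable
  qed
  finally show ?thesis .
qed

lemma cost_trivial: "n \<le> 1 \<Longrightarrow> i < n \<Longrightarrow> cost i x y = 0"
  by (auto simp: cost_def edge_cost_def)

text \<open>Without a second edge no interval can be crossed, so all expectations vanish and even
  \<open>m = 0\<close> is enough.\<close>

lemma learner_succeeds_trivial:
  assumes "n \<le> 1" "0 < \<epsilon>" "0 < \<delta>"
  shows "1 - \<delta> \<le> measure (\<Pi>\<^sub>M j\<in>{..<m}. D) {S \<in> space (\<Pi>\<^sub>M j\<in>{..<m}. D).
    expected_hop E L U D (learner E enum L U m S) \<le> expected_hop E L U D p + \<epsilon>}"
proof -
  interpret P: prob_space "\<Pi>\<^sub>M j\<in>{..<m}. D" by (intro prob_space_PiM prob_space_axioms)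
  have "expected_hop E L U D q = 0" for q
    using cost_trivial[OF assms(1)] by (simp add: expected_hop_eq risk_def)
  then show ?thesis using assms by (simp add: P.prob_space)
qed

end

section \<open>Sample complexity\<close>

definition sample_size :: "nat \<Rightarrow> real \<Rightarrow> real \<Rightarrow> nat" where
  "sample_size n \<epsilon> \<delta> =
     (if n \<le> 1 then 0 else nat \<lceil>6 * (real n ^ 4 / \<epsilon>\<^sup>2 * (2 * ln n - ln \<delta>))\<rceil>)"

text \<open>Rounding up costs at most 1, and 6 becomes 7 because the term \<open>Y\<close> is at
  least 1 for two or more edges. For no edge the right-hand side is 0 and for one edge it can be
  arbitrarily small, so \<open>sample_size\<close> is 0 there.\<close>

lemma sample_size_le:
  assumes "0 < \<epsilon>" "\<epsilon> < 1" "0 < \<delta>" "\<delta> < 1"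
  shows "real (sample_size n \<epsilon> \<delta>) \<le>
    7 * ((ln (real n) - ln (\<delta> / real n)) * (real n)\<^sup>2 / (\<epsilon> / real n)\<^sup>2)"
proof -
  consider "n = 0" | "n = 1" | "n \<ge> 2" by linarith
  then show ?thesis
  proof cases
    case 1
    then show ?thesis by (simp add: sample_size_def)
  next
    case 2
    then show ?thesis
      using assms ln_less_zero[of \<delta>] by (simp add: sample_size_def divide_le_0_iff)
  next
    case 3
    define Y where "Y = real n ^ 4 / \<epsilon>\<^sup>2 * (2 * ln n - ln \<delta>)"
    have "ln (1 / 2 :: real) \<le> 1 / 2 - 1" by (rule ln_le_minus_one) simp
    then have "1 / 2 \<le> ln (2 :: real)" by (simp add: ln_div)
    also have "\<dots> \<le> ln (real n)" using 3 by simp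
    finally have "1 / 2 \<le> ln (real n)" .
    moreover have "ln \<delta> < 0" using assms by simp
    ultimately have "1 \<le> 2 * ln n - ln \<delta>" by linarith
    moreover have "1 \<le> real n ^ 4 / \<epsilon>\<^sup>2"
    proof -
      have "\<epsilon>\<^sup>2 \<le> 1" "1 \<le> real n ^ 4" using assms 3 by (simp_all add: power_le_one)
      then show ?thesis using assms by simp
    qed
    ultimately have "1 * 1 \<le> Y" unfolding Y_def by (intro mult_mono) auto
    then have "real (sample_size n \<epsilon> \<delta>) \<le> 7 * Y"
      using 3 unfolding sample_size_def Y_def[symmetric] by simp linarith
    also have "Y = (ln (real n) - ln (\<delta> / real n)) * (real n)\<^sup>2 / (\<epsilon> / real n)\<^sup>2"
      using assms 3 by (simp add: Y_def ln_div field_simps power2_eq_square eval_nat_numeral)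
    finally show ?thesis .
  qed
qed

text \<open>The exponent is \<open>- X / 2\<close>, so the factor 6 produces
  \<open>\<delta> ^ 3 / n ^ 6\<close>. Three of the six powers of \<open>n\<close> cancel
  \<open>n ^ 3\<close>; the other three are at least 8 and pay for the factor 8.\<close>

lemma sample_size_sufficient:
  assumes "0 < \<epsilon>" "0 < \<delta>" "\<delta> < 1" "2 \<le> n" "sample_size n \<epsilon> \<delta> \<le> m"
  shows "8 * real n ^ 3 * exp (- 2 * real m * (\<epsilon> / (2 * n))\<^sup>2 / (real n)\<^sup>2) \<le> \<delta>"
proof -
  have two: "(2 :: real) ^ 3 \<le> real n ^ 3"
    using assms by (intro power_mono) auto
  have "6 * (real n ^ 4 / \<epsilon>\<^sup>2 * (2 * ln n - ln \<delta>)) \<le> m"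
    using assms unfolding sample_size_def by (simp split: if_splits)
  then have "6 * (real n ^ 4 / \<epsilon>\<^sup>2 * (2 * ln n - ln \<delta>)) * (\<epsilon>\<^sup>2 / real n ^ 4)
      \<le> m * (\<epsilon>\<^sup>2 / real n ^ 4)"
    by (rule mult_right_mono) simp
  moreover define X where "X = m * (\<epsilon>\<^sup>2 / real n ^ 4)"
  ultimately have "6 * (2 * ln n - ln \<delta>) \<le> X"
    using assms by simp
  moreover have "- 2 * real m * (\<epsilon> / (2 * n))\<^sup>2 / (real n)\<^sup>2 = - X / 2"
    using assms by (simp add: X_def field_simps eval_nat_numeral)
  ultimately have "- 2 * real m * (\<epsilon> / (2 * n))\<^sup>2 / (real n)\<^sup>2 \<le> 3 * ln \<delta> - 6 * ln n"
    by simp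
  then have "exp (- 2 * real m * (\<epsilon> / (2 * n))\<^sup>2 / (real n)\<^sup>2) \<le> exp (3 * ln \<delta> - 6 * ln n)"
    by simp
  also have "\<dots> = \<delta> ^ 3 / real n ^ 6"
    using assms by (simp add: exp_diff exp_of_nat_mult[of 3, simplified] exp_of_nat_mult[of 6, simplified])
  finally have "8 * real n ^ 3 * exp (- 2 * real m * (\<epsilon> / (2 * n))\<^sup>2 / (real n)\<^sup>2)
      \<le> 8 * real n ^ 3 * (\<delta> ^ 3 / real n ^ 6)"
    by (intro mult_left_mono) auto
  also have "\<dots> = \<delta> ^ 3 * (2 ^ 3 / real n ^ 3)"
    using assms by (simp add: field_simps eval_nat_numeral)
  also have "\<dots> \<le> \<delta> ^ 1 * 1"
    using assms two by (intro mult_mono power_decreasing) auto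
  finally show ?thesis by simp
qed

lemma sample_size_pos:
  assumes "0 < \<epsilon>" "0 < \<delta>" "\<delta> < 1" "2 \<le> n"
  shows "0 < sample_size n \<epsilon> \<delta>"
proof -
  have "ln \<delta> < 0" "0 < ln (real n)"
    using assms by simp_all
  then have "0 < 2 * ln (real n) - ln \<delta>" by linarith
  then show ?thesis using assms by (simp add: sample_size_def)
qed


text \<open>One program and one set of constants serve all instances, and \<open>A\<close> is chosen
  before \<open>D\<close>, so the learner knows the distribution only through its samples.\<close>

theorem theoremA3:
  "\<exists>(P :: com) (M :: nat \<Rightarrow> real \<Rightarrow> real \<Rightarrow> nat) (C :: real) (c :: nat) (d :: nat).
     \<forall>(V :: 'v set) (E :: 'e set) (ends :: 'e \<Rightarrow> 'v set) (L :: 'e \<Rightarrow> real) (U :: 'e \<Rightarrow> real)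
       (enum :: nat \<Rightarrow> 'e) (\<epsilon> :: real) (\<delta> :: real).
       graph V E ends \<longrightarrow> (\<forall>e\<in>E. L e \<le> U e) \<longrightarrow> bij_betw enum {..<card E} E \<longrightarrow>
       0 < \<epsilon> \<longrightarrow> \<epsilon> < 1 \<longrightarrow> 0 < \<delta> \<longrightarrow> \<delta> < 1 \<longrightarrow>
         real (M (card E) \<epsilon> \<delta>) \<le>
           C * ((ln (real (card E)) - ln (\<delta> / real (card E))) * (real (card E))\<^sup>2
                / (\<epsilon> / real (card E))\<^sup>2) \<and>
         (\<forall>m \<ge> M (card E) \<epsilon> \<delta>. \<exists>A :: (nat \<Rightarrow> 'e \<Rightarrow> real) \<Rightarrow> 'e \<Rightarrow> real.
            (\<forall>S \<in> (\<Pi>\<^sub>E j\<in>{..<m}. \<Pi>\<^sub>E e\<in>E. ival L U e).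
               A S \<in> predictions E L U \<and>
               (\<exists>t \<le> c * (m + card E + 1) ^ d. computes P E enum L U m S (A S) t)) \<and>
            (\<forall>D. value_distribution E L U D \<longrightarrow>
               (\<exists>p. is_arg_min (expected_hop E L U D) (\<lambda>p'. p' \<in> predictions E L U) p \<and>
                  measure (\<Pi>\<^sub>M j\<in>{..<m}. D)
                    {S \<in> space (\<Pi>\<^sub>M j\<in>{..<m}. D).
                       expected_hop E L U D (A S) \<le> expected_hop E L U D p + \<epsilon>} \<ge> 1 - \<delta>)))"
proof (rule exI[of _ erm_program], rule exI[of _ sample_size], rule exI[of _ 7],
    rule exI[of _ 103], rule exI[of _ 5], intro allI impI conjI)
  fix V :: "'v set" and E :: "'e set" and ends :: "'e \<Rightarrow> 'v set" and L U :: "'e \<Rightarrow> real"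
    and enum :: "nat \<Rightarrow> 'e" and \<epsilon> \<delta> :: real
  assume graph: "graph V E ends" and le: "\<forall>e\<in>E. L e \<le> U e"
    and enum: "bij_betw enum {..<card E} E"
    and \<epsilon>: "0 < \<epsilon>" "\<epsilon> < 1" and \<delta>: "0 < \<delta>" "\<delta> < 1"
  show "real (sample_size (card E) \<epsilon> \<delta>) \<le>
      7 * ((ln (real (card E)) - ln (\<delta> / real (card E))) * (real (card E))\<^sup>2
        / (\<epsilon> / real (card E))\<^sup>2)"
    by (rule sample_size_le[OF \<epsilon> \<delta>])
  fix m assume m: "sample_size (card E) \<epsilon> \<delta> \<le> m"
  show "\<exists>A :: (nat \<Rightarrow> 'e \<Rightarrow> real) \<Rightarrow> 'e \<Rightarrow> real.
      (\<forall>S \<in> (\<Pi>\<^sub>E j\<in>{..<m}. \<Pi>\<^sub>E e\<in>E. ival L U e).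
         A S \<in> predictions E L U \<and>
         (\<exists>t \<le> 103 * (m + card E + 1) ^ 5. computes erm_program E enum L U m S (A S) t)) \<and>
      (\<forall>D. value_distribution E L U D \<longrightarrow>
         (\<exists>p. is_arg_min (expected_hop E L U D) (\<lambda>p'. p' \<in> predictions E L U) p \<and>
            measure (\<Pi>\<^sub>M j\<in>{..<m}. D)
              {S \<in> space (\<Pi>\<^sub>M j\<in>{..<m}. D).
                 expected_hop E L U D (A S) \<le> expected_hop E L U D p + \<epsilon>} \<ge> 1 - \<delta>))"
  proof (intro exI[of _ "learner E enum L U m"] conjI ballI allI impI)
    fix S
    show "learner E enum L U m S \<in> predictions E L U"
      using le by (intro learner_in_predictions enum) simp
    show "\<exists>t\<le>103 * (m + card E + 1) ^ 5.
        computes erm_program E enum L U m S (learner E enum L U m S) t"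
      by (rule computes_learner[OF enum])
  next
    fix D assume "value_distribution E L U D"
    then interpret learning_instance E enum L U D
      using graph le enum by unfold_locales (auto simp: graph_def)
    obtain p where p: "p \<in> predictions E L U"
      "\<And>i y. i < card E \<Longrightarrow> admissible i y \<Longrightarrow> risk i (p (enum i)) \<le> risk i y"
      using optimal_prediction by blast
    show "\<exists>p. is_arg_min (expected_hop E L U D) (\<lambda>p'. p' \<in> predictions E L U) p \<and>
        measure (\<Pi>\<^sub>M j\<in>{..<m}. D)
          {S \<in> space (\<Pi>\<^sub>M j\<in>{..<m}. D).
             expected_hop E L U D (learner E enum L U m S) \<le> expected_hop E L U D p + \<epsilon>} \<ge> 1 - \<delta>"
    proof (intro exI[of _ p] conjI)
      show "is_arg_min (expected_hop E L U D) (\<lambda>p'. p' \<in> predictions E L U) p"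
        using p by (rule optimal_is_arg_min)
      show "measure (\<Pi>\<^sub>M j\<in>{..<m}. D)
          {S \<in> space (\<Pi>\<^sub>M j\<in>{..<m}. D).
             expected_hop E L U D (learner E enum L U m S) \<le> expected_hop E L U D p + \<epsilon>} \<ge> 1 - \<delta>"
      proof (cases "card E \<le> 1")
        case True
        then show ?thesis using \<epsilon>(1) \<delta>(1) by (rule learner_succeeds_trivial)
      next
        case False
        then have "2 \<le> card E" by simp
        then show ?thesis
          using sample_size_sufficient[OF \<epsilon>(1) \<delta> _ m] sample_size_pos[OF \<epsilon>(1) \<delta>] m
          by (intro learner_succeeds[OF p \<epsilon>(1)]) fastforce+
      qed
    qed
  qed
qed

end
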